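(* Let $\mathbf{F}$ be a field of characteristic $3$, let $r\in\mathbf{N}$, let $\lambda=(\lambda_1,\lambda_2)$ be a partition of $r$ (with $\lambda_2\ge 0$), and put $m=\lambda_1-\lambda_2$. Then the set \[\{\,e_{m,g} : g\in\mathbf{N}_0,\ g\le\lambda_2,\ B(m,g)\not\equiv 0 \pmod 3\,\}\] is a complete set of primitive orthogonal idempotents of $S_\mathbf{F}(\lambda)$.
   Context: For a partition $\lambda=(\lambda_1,\lambda_2)$ of $r$ with at most two parts, $M^\lambda$ denotes the $\mathbf{F}S_r$-permutation module on the cosets of the Young subgroup $S_{\lambda_1}\times S_{\lambda_2}$, and $S_\mathbf{F}(\lambda)=\operatorname{End}_{\mathbf{F}S_r}(M^\lambda)$. It is known that $S_\mathbf{F}(\lambda)$ is a commutative $\mathbf{F}$-algebra with basis $b(0),b(1),\dots,b(\lambda_2)$ (where $b(i)=1_\lambda f^{(i)}e^{(i)}1_\lambda$ in the Schur algebra), with $b(0)=\mathbf{1}$ the identity, and multiplication \[b(i)b(j)=\sum_{h=\max\{i,j\}}^{i+j}\binom{h}{i}\binom{h}{j}\binom{m+i+j}{i+j-h}b(h),\qquad m=\lambda_1-\lambda_2,\] with the convention $b(a)=0$ for $a>\lambda_2$. For $m,g\in\mathbf{N}_0$ set $B(m,g)=\binom{m+2g}{g}$. Given $m,g$ with $B(m,g)\not\equiv0\pmod 3$, write $m+2g=\sum_u (m+2g)_u3^u$ and $g=\sum_u g_u3^u$ in base $3$ and define index sets $I^{(0)}=\{u: g_u=0,(m+2g)_u=0\}$,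 $J^{(0)}=\{u:g_u=1,(m+2g)_u=2\}$, $I^{(1)}=\{u:g_u=0,(m+2g)_u=1\}$, $J^{(1)}=\{u:g_u=2,(m+2g)_u=2\}$, $I^{(2)}=\{u:g_u=0,(m+2g)_u=2\}$, $J^{(2)}=\{u:g_u=1,(m+2g)_u=1\}$. Define the element of $S_\mathbf{F}(\lambda)$ (for any $\lambda$ with $\lambda_1-\lambda_2=m$) \[e_{m,g}=\prod_{u\in I^{(0)}}(\mathbf{1}+b(3^u)-b(2\cdot3^u))\prod_{u\in J^{(0)}}(b(2\cdot3^u)-b(3^u))\prod_{u\in I^{(1)}}(\mathbf{1}-b(2\cdot3^u))\prod_{u\in J^{(1)}}b(2\cdot3^u)\prod_{u\in I^{(2)}}(\mathbf{1}-b(3^u)+b(2\cdot3^u))\prod_{u\in J^{(2)}}(b(3^u)-b(2\cdot3^u)),\] using the convention $b(a)=0$ for $a>\lambda_2$ (so all but finitely many factors equal $\mathbf{1}$). *)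

theory Defs
  imports Main "HOL-Library.Function_Algebras"
begin

text \<open>The algebra S_F(lambda) depends only on m = lambda_1 - lambda_2 and on l2 = lambda_2.
  It is modelled by its coordinate vectors with respect to the basis b(0),...,b(l2):
  an element is a function x :: nat => 'a vanishing above l2, meaning sum_i x i * b(i).\<close>

definition Scarrier :: "nat \<Rightarrow> (nat \<Rightarrow> 'a::field) set" where
  "Scarrier l2 = {x. \<forall>h. l2 < h \<longrightarrow> x h = 0}"

definition scoef :: "nat \<Rightarrow> nat \<Rightarrow> nat \<Rightarrow> nat \<Rightarrow> nat" where
  "scoef m i j h = (if max i j \<le> h \<and> h \<le> i + j
     then (h choose i) * (h choose j) * ((m + i + j) choose (i + j - h)) else 0)"

definition Smult :: "nat \<Rightarrow> nat \<Rightarrow> (nat \<Rightarrow> 'a::field) \<Rightarrow> (nat \<Rightarrow> 'a) \<Rightarrow> (nat \<Rightarrow> 'a)" where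
  "Smult m l2 x y = (\<lambda>h. if h \<le> l2 then
      (\<Sum>i\<le>l2. \<Sum>j\<le>l2. x i * y j * of_nat (scoef m i j h)) else 0)"

text \<open>Basis element b(a), with the convention b(a) = 0 for a > l2.\<close>
definition Sb :: "nat \<Rightarrow> nat \<Rightarrow> (nat \<Rightarrow> 'a::field)" where
  "Sb l2 a = (\<lambda>h. if a \<le> l2 \<and> h = a then 1 else 0)"

definition Sone :: "nat \<Rightarrow> (nat \<Rightarrow> 'a::field)" where
  "Sone l2 = Sb l2 0"

definition Sidem :: "nat \<Rightarrow> nat \<Rightarrow> (nat \<Rightarrow> 'a::field) \<Rightarrow> bool" where
  "Sidem m l2 e \<longleftrightarrow> e \<in> Scarrier l2 \<and> Smult m l2 e e = e"

definition Sprimitive_idem :: "nat \<Rightarrow> nat \<Rightarrow> (nat \<Rightarrow> 'a::field) \<Rightarrow> bool" where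
  "Sprimitive_idem m l2 e \<longleftrightarrow> Sidem m l2 e \<and> e \<noteq> 0 \<and>
     (\<forall>a b. Sidem m l2 a \<and> Sidem m l2 b \<and> Smult m l2 a b = 0 \<and> Smult m l2 b a = 0
        \<and> a + b = e \<longrightarrow> a = 0 \<or> b = 0)"

definition complete_prim_orth_idems :: "nat \<Rightarrow> nat \<Rightarrow> (nat \<Rightarrow> 'a::field) set \<Rightarrow> bool" where
  "complete_prim_orth_idems m l2 E \<longleftrightarrow> finite E \<and>
     (\<forall>e\<in>E. Sprimitive_idem m l2 e) \<and>
     (\<forall>e\<in>E. \<forall>f\<in>E. e \<noteq> f \<longrightarrow> Smult m l2 e f = 0) \<and>
     sum id E = Sone l2"

definition digit3 :: "nat \<Rightarrow> nat \<Rightarrow> nat" where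
  "digit3 n u = n div 3 ^ u mod 3"

definition Bmg :: "nat \<Rightarrow> nat \<Rightarrow> nat" where
  "Bmg m g = (m + 2 * g) choose g"

text \<open>The factor of e_{m,g} indexed by u (equal to 1 when u lies in none of the six index sets).\<close>
definition efactor :: "nat \<Rightarrow> nat \<Rightarrow> nat \<Rightarrow> nat \<Rightarrow> (nat \<Rightarrow> 'a::field)" where
  "efactor m l2 g u = (let gu = digit3 g u; nu = digit3 (m + 2 * g) u;
      b1 = Sb l2 (3 ^ u); b2 = Sb l2 (2 * 3 ^ u) in
     if gu = 0 \<and> nu = 0 then Sone l2 + b1 - b2
     else if gu = 1 \<and> nu = 2 then b2 - b1
     else if gu = 0 \<and> nu = 1 then Sone l2 - b2
     else if gu = 2 \<and> nu = 2 then b2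
     else if gu = 0 \<and> nu = 2 then Sone l2 - b1 + b2
     else if gu = 1 \<and> nu = 1 then b1 - b2
     else Sone l2)"

text \<open>e_{m,g}: product of all factors. For u \<ge> m + 2g + l2 + 1 we have 3^u > l2 and
  both digits are 0, so the factor is the identity; hence the finite range suffices.\<close>
definition emg :: "nat \<Rightarrow> nat \<Rightarrow> nat \<Rightarrow> (nat \<Rightarrow> 'a::field)" where
  "emg m l2 g = foldr (Smult m l2) (map (efactor m l2 g) [0..<m + 2 * g + l2 + 1]) (Sone l2)"

end

theory Submission
  imports Defs "HOL-Number_Theory.Cong"
begin

text \<open>Over the integers the algebra is separated by the characters
  \<open>b(j) \<mapsto> (t choose j) * (m + t + j choose j)\<close>, which gives associativity. In characteristic 3,
  write \<open>q = 3^u\<close>, \<open>b1 = b(q)\<close>, \<open>b2 = b(2 q)\<close> and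
  \<open>Z = (\<Sum>0<k<q. (m mod q choose q - k) b(k))\<close>. By Lucas' congruence \<open>b(a q) b(k) = b(a q + k)\<close> for
  \<open>k < q\<close>, and \<open>b1\<close>, \<open>b2\<close> span, together with 1, an algebra over the ring generated by \<open>Z\<close>.
  The product \<open>E\<close> of the factors of \<open>e_{m,g}\<close> below level \<open>u\<close> is an eigenvector of \<open>Z\<close>, with
  eigenvalue the carry \<open>c\<close> into digit \<open>u\<close> of the addition \<open>m + 2 g\<close>. On \<open>E\<close> the relations between
  \<open>b1\<close> and \<open>b2\<close> therefore depend only on \<open>s = (m_u + c) mod 3\<close>, and for each \<open>s\<close> the two admissible
  digits \<open>g_u\<close> yield complementary idempotent factors. For primitivity, \<open>b(i)^3\<close> acts on \<open>e_{m,g}\<close>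
  as a scalar; by additivity of cubing so does \<open>x^3\<close> for every \<open>x\<close>, hence an idempotent \<open>x\<close>
  satisfies \<open>x e_{m,g} \<in> {0, e_{m,g}}\<close>.\<close>

section \<open>Associativity of the structure constants\<close>


text \<open>The eigenvalue of \<open>f^(j) e^(j)\<close> on the vectors of weight \<open>m\<close>
  in the simple \<open>sl_2\<close>-module of highest weight \<open>m + 2 t\<close>.\<close>

definition schar :: "nat \<Rightarrow> nat \<Rightarrow> nat \<Rightarrow> int" where
  "schar m t j = int (t choose j) * int ((m + t + j) choose j)"

lemma scoef_eq: "scoef m i j h =
    (if h \<le> i + j then (h choose i) * (h choose j) * ((m + i + j) choose (i + j - h)) else 0)"
  by (auto simp: scoef_def binomial_eq_0)

lemma scoef_commute: "scoef m i j h = scoef m j i h"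
  by (simp add: scoef_eq ac_simps)

lemma scoef_0_left: "scoef m 0 j h = (if h = j then 1 else 0)"
  by (auto simp: scoef_eq binomial_eq_0)

lemma int_Suc_times_choose_Suc: "(int i + 1) * int (h choose Suc i) = (int h - int i) * int (h choose i)"
proof (cases "i \<le> h")
  case True
  have "Suc i * (h choose Suc i) = (h - i) * (h choose i)"
    by (metis binomial_absorb_comp binomial_absorption mult.commute diff_Suc_1)
  then have "int (Suc i) * int (h choose Suc i) = int (h - i) * int (h choose i)"
    by (metis of_nat_mult)
  with True show ?thesis by (simp add: add.commute)
qed (simp add: binomial_eq_0)

lemma int_times_pred_choose: "int (Suc h) * int (h choose i) = (int (Suc h) - int i) * int (Suc h choose i)"
proof (cases "i \<le> h")
  case True
  have "Suc h * (h choose i) = (Suc h - i) * (Suc h choose i)"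
    using binomial_absorb_comp[of "Suc h" i] by simp
  then have "int (Suc h) * int (h choose i) = int (Suc h - i) * int (Suc h choose i)"
    by (metis of_nat_mult)
  with True show ?thesis by (simp add: add.commute)
next
  case False then show ?thesis by (cases "i = Suc h") (auto simp: binomial_eq_0)
qed

lemma schar_Suc:
  "(int j + 1)^2 * schar m t (Suc j) = (int t - int j) * (int m + int t + int j + 1) * schar m t j"
proof -
  have a: "(int j + 1) * int (t choose Suc j) = (int t - int j) * int (t choose j)"
    by (rule int_Suc_times_choose_Suc)
  have "Suc j * (Suc (m + t + j) choose Suc j) = Suc (m + t + j) * (m + t + j choose j)"
    by (metis Suc_times_binomial_eq mult.commute)
  then have b: "(int j + 1) * int (m + t + Suc j choose Suc j) = (int m + int t + int j + 1) * int (m + t + j choose j)"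
    by (metis (no_types, lifting) add_Suc_right of_nat_mult of_nat_Suc of_nat_add add.commute)
  have "(int j + 1)^2 * schar m t (Suc j)
      = ((int j + 1) * int (t choose Suc j)) * ((int j + 1) * int (m + t + Suc j choose Suc j))"
    by (simp add: schar_def power2_eq_square)
  also have "\<dots> = (int t - int j) * (int m + int t + int j + 1) * schar m t j"
    unfolding a b by (simp add: schar_def)
  finally show ?thesis .
qed

text \<open>The recursion that \<open>schar_Suc\<close> forces on the structure constants: compare
  the coefficients of \<open>schar m t (Suc h)\<close> in \<open>(i + 1)^2\<close> times the product
  of the values at \<open>i + 1\<close> and \<open>j\<close>. Pascal's rule and absorption reduce
  all binomials to those of \<open>Suc h\<close> and of \<open>m + i + j\<close>.\<close>

lemma scoef_Suc_left:
  "(int i + 1)^2 * int (scoef m (Suc i) j (Suc h))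
   = (int h + 1)^2 * int (scoef m i j h)
     + (int h + 1 - int i) * (int m + int h + int i + 2) * int (scoef m i j (Suc h))"
proof -
  let ?H = "int h + 1"
  let ?A = "int (Suc h choose i)" and ?B = "int (Suc h choose j)"
  have 1: "(int i + 1) * int (Suc h choose Suc i) = (?H - int i) * ?A"
    using int_Suc_times_choose_Suc[of i "Suc h"] by (simp add: add.commute)
  have 2: "?H * int (h choose i) = (?H - int i) * ?A"
    using int_times_pred_choose[of h i] by (simp add: add.commute)
  have 3: "?H * int (h choose j) = (?H - int j) * ?B"
    using int_times_pred_choose[of h j] by (simp add: add.commute)
  \<comment> \<open>At \<open>h = i + j\<close> the last binomial would have a negative lower index,
    which subtraction in \<open>nat\<close> cannot express, so this case stands alone.\<close>
  consider (lt) "h < i + j" | (eq) "h = i + j" | (gt) "i + j < h" by linarith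
  then show ?thesis
  proof cases
    case gt then show ?thesis by (simp add: scoef_eq)
  next
    case eq
    have "(int i + 1)^2 * int (scoef m (Suc i) j (Suc h)) = (int i + 1) * ((int i + 1) * int (Suc h choose Suc i)) * ?B"
      using eq by (simp add: scoef_eq power2_eq_square)
    also have "\<dots> = (?H * int (h choose i)) * (?H * int (h choose j))"
      unfolding 1 2 3 using eq by (simp add: algebra_simps)
    finally show ?thesis using eq by (simp add: scoef_eq power2_eq_square)
  next
    case lt
    define k where "k = i + j - Suc h"
    define N where "N = m + i + j"
    have k: "i + j - h = Suc k" "Suc i + j - Suc h = Suc k" "i + j - Suc h = k" "int k = int i + int j - ?H"
      using lt by (auto simp: k_def)
    have 4: "(int k + 1) * int (N choose Suc k) = (int m + ?H) * int (N choose k)"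
      using int_Suc_times_choose_Suc[of k N] k(4) by (simp add: N_def)
    have N: "m + Suc i + j = Suc N" by (simp add: N_def)
    have "(int i + 1)^2 * int (scoef m (Suc i) j (Suc h))
        = (int i + 1) * ((int i + 1) * int (Suc h choose Suc i)) * ?B * (int (N choose k) + int (N choose Suc k))"
      using lt k(2) N by (simp add: scoef_eq power2_eq_square)
    also have "\<dots> = (?H - int i) * ?A * ?B * ((int i + 1) * (int (N choose k) + int (N choose Suc k)))"
      unfolding 1 by (simp add: algebra_simps)
    also have "(int i + 1) * (int (N choose k) + int (N choose Suc k))
       = (int k + 1) * int (N choose Suc k) + (?H - int j) * int (N choose Suc k) + (int i + 1) * int (N choose k)"
      unfolding k(4) by (simp add: algebra_simps)
    also have "\<dots> = (?H - int j) * int (N choose Suc k) + (int m + ?H + int i + 1) * int (N choose k)"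
      unfolding 4 by (simp add: algebra_simps)
    also have "(?H - int i) * ?A * ?B * \<dots> = ((?H - int i) * ?A) * ((?H - int j) * ?B) * int (N choose Suc k)
        + (?H - int i) * (int m + ?H + int i + 1) * (?A * ?B * int (N choose k))"
      by (simp add: algebra_simps)
    also have "((?H - int i) * ?A) * ((?H - int j) * ?B) * int (N choose Suc k)
        = (?H * int (h choose i)) * (?H * int (h choose j)) * int (N choose Suc k)"
      unfolding 2 3 ..
    also have "\<dots> = ?H^2 * int (scoef m i j h)"
      using lt k(1) by (simp add: scoef_eq power2_eq_square N_def)
    also have "?A * ?B * int (N choose k) = int (scoef m i j (Suc h))"
      using lt k(3) by (simp add: scoef_eq N_def)
    finally show ?thesis by (simp add: add.commute add.left_commute)
  qed
qed

lemma scoef_Suc_0: "scoef m (Suc i) j 0 = 0" by (simp add: scoef_def)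

lemma scoef_eq_0: "h < i \<or> h < j \<or> i + j < h \<Longrightarrow> scoef m i j h = 0"
  by (auto simp: scoef_def)

lemma schar_mult:
  "schar m t i * schar m t j = (\<Sum>h\<le>i+j. int (scoef m i j h) * schar m t h)"
proof (induction i)
  case 0
  have "(\<Sum>h\<le>j. int (scoef m 0 j h) * schar m t h) = (\<Sum>h\<le>j. if h = j then schar m t h else 0)"
    by (intro sum.cong) (auto simp: scoef_0_left)
  then show ?case by (simp add: schar_def)
next
  case (Suc i)
  let ?X = "\<lambda>i. (int t - int i) * (int m + int t + int i + 1)"
  let ?s = "\<lambda>h. int (scoef m i j h)"
  \<comment> \<open>The factor for \<open>i\<close> is the factor for \<open>h\<close> plus a
    correction. The first part raises \<open>h\<close> to \<open>Suc h\<close> by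
    \<open>schar_Suc\<close>, the second leaves \<open>h\<close> fixed; this is the shape of
    \<open>scoef_Suc_left\<close>.\<close>
  have d: "?X i = ?X h + (int h - int i) * (int m + int h + int i + 1)" for h
    by (simp add: algebra_simps)
  have "(int i + 1)^2 * (schar m t (Suc i) * schar m t j) = ?X i * (schar m t i * schar m t j)"
    using schar_Suc[of i m t] by (simp only: mult.assoc[symmetric])
  also have "\<dots> = (\<Sum>h\<le>i+j. ?s h * (?X i * schar m t h))"
    unfolding Suc.IH by (simp add: sum_distrib_left ac_simps)
  also have "\<dots> = (\<Sum>h\<le>i+j. ?s h * (int h + 1)^2 * schar m t (Suc h)
       + ?s h * (int h - int i) * (int m + int h + int i + 1) * schar m t h)"
  proof (intro sum.cong refl)
    fix h
    have "?X i * schar m t h = ?X h * schar m t h + (int h - int i) * (int m + int h + int i + 1) * schar m t h"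
      by (subst d[of h]) (rule distrib_right)
    also have "?X h * schar m t h = (int h + 1)^2 * schar m t (Suc h)"
      using schar_Suc[of h m t] by simp
    finally show "?s h * (?X i * schar m t h) = ?s h * (int h + 1)^2 * schar m t (Suc h)
       + ?s h * (int h - int i) * (int m + int h + int i + 1) * schar m t h"
      by (simp add: algebra_simps)
  qed
  also have "\<dots> = (\<Sum>h\<le>i+j. ?s h * (int h + 1)^2 * schar m t (Suc h))
      + (\<Sum>h\<le>Suc(i+j). ?s h * (int h - int i) * (int m + int h + int i + 1) * schar m t h)"
    by (simp add: sum.distrib scoef_eq_0)
  also have "(\<Sum>h\<le>Suc(i+j). ?s h * (int h - int i) * (int m + int h + int i + 1) * schar m t h)
     = (\<Sum>h\<le>i+j. ?s (Suc h) * (int h + 1 - int i) * (int m + int h + int i + 2) * schar m t (Suc h))"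
    by (subst sum.atMost_Suc_shift) (auto simp: scoef_eq add.commute add.left_commute intro!: sum.cong)
  also have "(\<Sum>h\<le>i+j. ?s h * (int h + 1)^2 * schar m t (Suc h)) + \<dots>
     = (\<Sum>h\<le>i+j. (int i + 1)^2 * int (scoef m (Suc i) j (Suc h)) * schar m t (Suc h))"
    unfolding scoef_Suc_left sum.distrib[symmetric]
    by (intro sum.cong refl) (simp add: algebra_simps)
  also have "\<dots> = (int i + 1)^2 * (\<Sum>h\<le>Suc i+j. int (scoef m (Suc i) j h) * schar m t h)"
    by (simp only: add_Suc sum.atMost_Suc_shift scoef_Suc_0) (simp add: sum_distrib_left mult.assoc)
  finally show ?case
    by (simp add: mult_left_cancel)
qed

lemma schar_eq_0: "t < j \<Longrightarrow> schar m t j = 0"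
  by (simp add: schar_def binomial_eq_0)

lemma schar_diag: "schar m t t \<noteq> 0"
  by (simp add: schar_def)

text \<open>The matrix \<open>schar m t h\<close> is triangular with nonzero diagonal, so the
  coefficients are determined one after another from \<open>t = 0\<close> upwards.\<close>

lemma schar_inj:
  assumes "\<And>t. t \<le> n \<Longrightarrow> (\<Sum>h\<le>n. x h * schar m t h) = (\<Sum>h\<le>n. y h * schar m t h)"
    and "k \<le> n"
  shows "x k = y k"
  using \<open>k \<le> n\<close>
proof (induction k rule: less_induct)
  case (less k)
  have "(\<Sum>h\<le>n. (x h - y h) * schar m k h) = 0"
    using assms(1)[OF less.prems] by (simp add: left_diff_distrib sum_subtractf)
  also have "(\<Sum>h\<le>n. (x h - y h) * schar m k h) = (\<Sum>h\<in>{k}. (x h - y h) * schar m k h)"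
  proof (intro sum.mono_neutral_right ballI)
    fix h assume "h \<in> {..n} - {k}"
    then show "(x h - y h) * schar m k h = 0"
      using less.IH[of h] by (cases "h < k") (auto simp: schar_eq_0)
  qed (use less.prems in auto)
  finally show ?case using schar_diag by simp
qed

text \<open>Every character takes both sides to the same product of three values, and the characters
  separate elements. Rotating the factors brings the right side into the form of the left.\<close>

lemma scoef_assoc:
  "(\<Sum>p\<le>l. scoef m i j p * scoef m p k l) = (\<Sum>p\<le>l. scoef m j k p * scoef m i p l)"
proof -
  define n where "n = i + j + k + l"
  have expand: "(\<Sum>h\<le>n. (\<Sum>p\<le>n. int (scoef m a b p) * int (scoef m p c h)) * schar m t h)
      = schar m t a * schar m t b * schar m t c" if "a + b + c \<le> n" for a b c t
  proof -
    have ext: "(\<Sum>h\<le>n. int (scoef m a b h) * schar m t h) = schar m t a * schar m t b" if "a + b \<le> n" for a b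
      unfolding schar_mult using that
      by (intro sum.mono_neutral_right) (auto simp: scoef_eq_0)
    have "(\<Sum>h\<le>n. (\<Sum>p\<le>n. int (scoef m a b p) * int (scoef m p c h)) * schar m t h)
       = (\<Sum>p\<le>n. int (scoef m a b p) * (\<Sum>h\<le>n. int (scoef m p c h) * schar m t h))"
      by (simp add: sum_distrib_left sum_distrib_right mult.assoc) (rule sum.swap)
    also have "\<dots> = (\<Sum>p\<le>n. int (scoef m a b p) * (schar m t p * schar m t c))"
    proof (intro sum.cong refl)
      fix p show "int (scoef m a b p) * (\<Sum>h\<le>n. int (scoef m p c h) * schar m t h)
          = int (scoef m a b p) * (schar m t p * schar m t c)"
        using that ext[of p c] by (cases "p \<le> a + b") (auto simp: scoef_eq_0)
    qed
    also have "\<dots> = (\<Sum>p\<le>n. int (scoef m a b p) * schar m t p) * schar m t c"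
      by (simp add: sum_distrib_right mult.assoc)
    finally show ?thesis using ext[of a b] that by simp
  qed
  have "(\<Sum>p\<le>n. int (scoef m i j p) * int (scoef m p k l)) = (\<Sum>p\<le>n. int (scoef m j k p) * int (scoef m p i l))"
  proof (rule schar_inj[where n = n and m = m and k = l])
    have "i + j + k \<le> n" "j + k + i \<le> n" by (simp_all add: n_def)
    then show "(\<Sum>h\<le>n. (\<Sum>p\<le>n. int (scoef m i j p) * int (scoef m p k h)) * schar m t h)
        = (\<Sum>h\<le>n. (\<Sum>p\<le>n. int (scoef m j k p) * int (scoef m p i h)) * schar m t h)" for t
      by (simp add: expand)
  qed (simp add: n_def)
  moreover have "(\<Sum>p\<le>n. int (scoef m a b p) * int (scoef m p c l)) = int (\<Sum>p\<le>l. scoef m a b p * scoef m p c l)" for a b c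
    unfolding of_nat_sum of_nat_mult
    by (intro sum.mono_neutral_right) (auto simp: n_def scoef_eq_0)
  ultimately show ?thesis
    by (simp add: scoef_commute[of m i] del: of_nat_sum)
qed


lemma times_of_nat_scoef_0_left: "a * of_nat (scoef m 0 j h) = (if h = j then a else 0)"
  by (simp add: scoef_0_left)

section \<open>The completed algebra\<close>

text \<open>The product over all \<open>m\<close> of the untruncated algebras, infinite linear combinations being
  allowed. It depends on no parameter, so it is an instance of \<open>comm_ring_1\<close>; the element
  \<open>scomp m 1\<close> defined below is the idempotent that projects to the component \<open>m\<close>.\<close>

typedef 'a salg = "UNIV :: (nat \<Rightarrow> nat \<Rightarrow> 'a) set"
  morphisms coef Salg ..

lemmas coef_Salg [simp] = Salg_inverse[OF UNIV_I]

lemma salg_eqI: "(\<And>m h. coef x m h = coef y m h) \<Longrightarrow> x = y"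
  by (metis coef_inject ext)

instantiation salg :: (comm_ring_1) comm_ring_1
begin

definition "0 = Salg (\<lambda>m h. 0)"
definition "1 = Salg (\<lambda>m h. if h = 0 then 1 else 0)"
definition "x + y = Salg (\<lambda>m h. coef x m h + coef y m h)"
definition "- x = Salg (\<lambda>m h. - coef x m h)"
definition "x - y = Salg (\<lambda>m h. coef x m h - coef y m h)"
definition "x * y = Salg (\<lambda>m h. \<Sum>i\<le>h. \<Sum>j\<le>h. coef x m i * coef y m j * of_nat (scoef m i j h))"

lemma coef_simps [simp]:
  "coef (0 :: 'a salg) m h = 0"
  "coef (1 :: 'a salg) m h = (if h = 0 then 1 else 0)"
  "coef (x + y) m h = coef x m h + coef y m h"
  "coef (- x) m h = - coef x m h"
  "coef (x - y) m h = coef x m h - coef y m h"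
  by (simp_all add: zero_salg_def one_salg_def plus_salg_def uminus_salg_def minus_salg_def)

lemma coef_mult:
  "coef (x * y) m h = (\<Sum>i\<le>h. \<Sum>j\<le>h. coef x m i * coef y m j * of_nat (scoef m i j h))"
  by (simp add: times_salg_def)

lemma coef_mult_ext:
  assumes "h \<le> n"
  shows "coef (x * y) m h = (\<Sum>i\<le>n. \<Sum>j\<le>n. coef x m i * coef y m j * of_nat (scoef m i j h))"
proof -
  have "(\<Sum>i\<le>n. \<Sum>j\<le>n. coef x m i * coef y m j * of_nat (scoef m i j h))
     = (\<Sum>i\<le>h. \<Sum>j\<le>n. coef x m i * coef y m j * of_nat (scoef m i j h))"
    by (intro sum.mono_neutral_right) (use assms in \<open>auto simp: scoef_eq_0\<close>)
  also have "\<dots> = coef (x * y) m h"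
    unfolding coef_mult
    by (intro sum.cong refl sum.mono_neutral_right) (use assms in \<open>auto simp: scoef_eq_0\<close>)
  finally show ?thesis ..
qed

lemma coef_mult3:
  "coef (x * y * z) m h = (\<Sum>i\<le>h. \<Sum>j\<le>h. \<Sum>k\<le>h. coef x m i * coef y m j * coef z m k
      * of_nat (\<Sum>p\<le>h. scoef m i j p * scoef m p k h))"
proof -
  let ?f = "\<lambda>i j k p. coef x m i * coef y m j * coef z m k * of_nat (scoef m i j p * scoef m p k h)"
  have "coef (x * y * z) m h = (\<Sum>p\<le>h. \<Sum>k\<le>h. (\<Sum>i\<le>h. \<Sum>j\<le>h. coef x m i * coef y m j * of_nat (scoef m i j p))
      * coef z m k * of_nat (scoef m p k h))"
    unfolding coef_mult[of "x * y"] by (intro sum.cong refl) (simp add: coef_mult_ext[of _ h])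
  also have "\<dots> = (\<Sum>p\<le>h. \<Sum>k\<le>h. \<Sum>i\<le>h. \<Sum>j\<le>h. ?f i j k p)"
    by (simp add: sum_distrib_left sum_distrib_right ac_simps)
  also have "\<dots> = (\<Sum>k\<le>h. \<Sum>p\<le>h. \<Sum>i\<le>h. \<Sum>j\<le>h. ?f i j k p)" by (rule sum.swap)
  also have "\<dots> = (\<Sum>k\<le>h. \<Sum>i\<le>h. \<Sum>p\<le>h. \<Sum>j\<le>h. ?f i j k p)"
    by (intro sum.cong refl sum.swap)
  also have "\<dots> = (\<Sum>i\<le>h. \<Sum>k\<le>h. \<Sum>p\<le>h. \<Sum>j\<le>h. ?f i j k p)" by (rule sum.swap)
  also have "\<dots> = (\<Sum>i\<le>h. \<Sum>k\<le>h. \<Sum>j\<le>h. \<Sum>p\<le>h. ?f i j k p)"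
    by (intro sum.cong refl sum.swap)
  also have "\<dots> = (\<Sum>i\<le>h. \<Sum>j\<le>h. \<Sum>k\<le>h. \<Sum>p\<le>h. ?f i j k p)"
    by (intro sum.cong refl sum.swap)
  finally show ?thesis by (simp only: sum_distrib_left of_nat_sum)
qed

instance
proof
  fix x y z :: "'a salg"
  have comm: "a * b = b * a" for a b :: "'a salg"
    by (rule salg_eqI, unfold coef_mult, subst sum.swap) (simp add: scoef_commute ac_simps)
  show "x * y = y * x" by (rule comm)
  show "x * y * z = x * (y * z)"
  proof (rule salg_eqI)
    fix m h
    have "coef (x * (y * z)) m h = coef (y * z * x) m h" by (simp add: comm)
    also have "\<dots> = (\<Sum>j\<le>h. \<Sum>k\<le>h. \<Sum>i\<le>h. coef x m i * coef y m j * coef z m k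
        * of_nat (\<Sum>p\<le>h. scoef m i j p * scoef m p k h))"
    proof -
      have "(\<Sum>p\<le>h. scoef m j k p * scoef m p i h) = (\<Sum>p\<le>h. scoef m i j p * scoef m p k h)" for i j k
        unfolding scoef_assoc[of m i] by (intro sum.cong refl) (metis scoef_commute)
      then show ?thesis
        unfolding coef_mult3 by (intro sum.cong refl) (simp add: ac_simps del: of_nat_sum)
    qed
    also have "\<dots> = (\<Sum>j\<le>h. \<Sum>i\<le>h. \<Sum>k\<le>h. coef x m i * coef y m j * coef z m k
        * of_nat (\<Sum>p\<le>h. scoef m i j p * scoef m p k h))"
      by (intro sum.cong refl sum.swap)
    also have "\<dots> = (\<Sum>i\<le>h. \<Sum>j\<le>h. \<Sum>k\<le>h. coef x m i * coef y m j * coef z m k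
        * of_nat (\<Sum>p\<le>h. scoef m i j p * scoef m p k h))" by (rule sum.swap)
    finally show "coef (x * y * z) m h = coef (x * (y * z)) m h" by (simp add: coef_mult3)
  qed
  show "1 * x = x"
  proof (rule salg_eqI)
    fix m h
    have "coef (1 * x) m h = (\<Sum>i\<in>{0}. \<Sum>j\<le>h. coef 1 m i * coef x m j * of_nat (scoef m i j h))"
      unfolding coef_mult by (intro sum.mono_neutral_right) auto
    then show "coef (1 * x) m h = coef x m h" by (simp add: times_of_nat_scoef_0_left)
  qed
  show "(x + y) * z = x * z + y * z"
    by (rule salg_eqI) (simp add: coef_mult distrib_right sum.distrib)
  show "(0 :: 'a salg) \<noteq> 1"
    by (metis coef_simps(1,2) zero_neq_one)
qed (auto intro!: salg_eqI)

end

definition sb :: "nat \<Rightarrow> 'a::comm_ring_1 salg" where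
  "sb a = Salg (\<lambda>m h. if h = a then 1 else 0)"

text \<open>For general \<open>c\<close> this is the scalar \<open>c\<close> acting on the component
  \<open>m\<close>.\<close>

definition scomp :: "nat \<Rightarrow> 'a \<Rightarrow> 'a::comm_ring_1 salg" where
  "scomp m c = Salg (\<lambda>n h. if n = m \<and> h = 0 then c else 0)"

lemma coef_sb [simp]: "coef (sb a) m h = (if h = a then 1 else 0)" by (simp add: sb_def)

lemma coef_scomp [simp]: "coef (scomp m c) n h = (if n = m \<and> h = 0 then c else 0)" by (simp add: scomp_def)

lemma sb_0: "sb 0 = 1" by (rule salg_eqI) simp

lemma coef_sum [simp]: "coef (sum f A) m h = (\<Sum>a\<in>A. coef (f a) m h)"
  by (induction A rule: infinite_finite_induct) auto

lemma coef_of_nat: "coef (of_nat n) m h = (if h = 0 then of_nat n else 0)"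
  by (induction n) auto

lemma coef_scomp_mult [simp]: "coef (scomp m c * x) n h = (if n = m then c * coef x m h else 0)"
proof -
  have "coef (scomp m c * x) n h = (\<Sum>i\<in>{0}. \<Sum>j\<le>h. coef (scomp m c) n i * coef x n j * of_nat (scoef n i j h))"
    unfolding coef_mult by (intro sum.mono_neutral_right) auto
  then show ?thesis by (simp add: times_of_nat_scoef_0_left)
qed

lemma coef_of_nat_mult [simp]: "coef (of_nat c * x) m h = of_nat c * coef x m h"
  by (induction c) (auto simp: distrib_right)

lemma scomp_mult: "scomp m c * scomp m d = scomp m (c * d)"
  by (rule salg_eqI) auto

lemma coef_sb_mult:
  "coef (sb i * sb j) m h = of_nat (scoef m i j h)"
proof -
  define n where "n = h + i + j"
  have "coef (sb i * sb j :: 'a salg) m h = (\<Sum>a\<le>n. \<Sum>b\<le>n. if j = b then (if i = a then of_nat (scoef m a b h) else 0) else 0)"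
    by (subst coef_mult_ext[of h n]) (simp add: n_def, intro sum.cong refl, simp)
  then show ?thesis by (simp add: n_def)
qed


section \<open>Multiplication in prime characteristic\<close>

lemma prime_dvd_prime_power_choose:
  fixes p :: nat
  assumes "prime p" "0 < j" "j < p ^ u"
  shows "p dvd (p ^ u choose j)"
proof (rule ccontr)
  assume "\<not> p dvd (p ^ u choose j)"
  then have "coprime (p ^ u) (p ^ u choose j)"
    using assms(1) by (simp add: prime_imp_coprime)
  \<comment> \<open>By absorption, \<open>j\<close> times the binomial is \<open>p ^ u\<close> times
    another binomial; coprimality then forces \<open>p ^ u\<close> to divide \<open>j\<close>, which
    is smaller.\<close>
  moreover have "p ^ u dvd j * (p ^ u choose j)"
    using assms by (metis Suc_pred' binomial_absorption times_binomial_minus1_eq dvd_triv_left)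
  ultimately have "p ^ u dvd j"
    by (simp add: coprime_dvd_mult_left_iff)
  then show False using assms by (simp add: nat_dvd_not_less)
qed

text \<open>Vandermonde's convolution: modulo \<open>p\<close> only the terms \<open>j = 0\<close>
  and \<open>j = p ^ u\<close> survive.\<close>

lemma prime_power_add_choose_cong:
  fixes p :: nat
  assumes "prime p"
  shows "[(p ^ u + n choose r) = (n choose r) + (if p ^ u \<le> r then n choose (r - p ^ u) else 0)] (mod p)"
proof -
  let ?q = "p ^ u"
  have q: "0 < ?q" using assms by (simp add: prime_gt_0_nat)
  let ?g = "\<lambda>j. (if j = 0 then n choose r else 0) + (if j = ?q then n choose (r - j) else 0)"
  have "[(\<Sum>j\<le>r. (?q choose j) * (n choose (r - j))) = (\<Sum>j\<le>r. ?g j)] (mod p)"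
  proof (rule cong_sum)
    fix j
    have "p dvd (?q choose j)" if "j \<noteq> 0" "j \<noteq> ?q"
    proof (cases "j < ?q")
      case True
      with that show ?thesis using assms by (intro prime_dvd_prime_power_choose) auto
    next
      case False
      with that show ?thesis by (simp add: binomial_eq_0)
    qed
    then show "[(?q choose j) * (n choose (r - j)) = ?g j] (mod p)"
      using q by (cases "j = 0"; cases "j = ?q") (auto simp: cong_0_iff)
  qed
  then show ?thesis
    unfolding vandermonde by (simp add: sum.distrib)
qed

text \<open>Induction on \<open>a\<close>: adding \<open>p ^ u\<close> once more amounts to Pascal's
  rule for the upper digits.\<close>

lemma lucas_prime_power:
  fixes p :: nat
  assumes p: "prime p" and "k < p ^ u" "l < p ^ u"
  shows "[(a * p ^ u + k choose (b * p ^ u + l)) = (a choose b) * (k choose l)] (mod p)"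
proof (induction a arbitrary: b)
  case 0
  show ?case
  proof (cases b)
    case (Suc b')
    then have "k < b * p ^ u + l" using assms(2) by (simp add: trans_less_add1)
    with Suc show ?thesis by (simp add: binomial_eq_0)
  qed simp
next
  case (Suc a)
  let ?q = "p ^ u"
  have s: "[(Suc a * ?q + k choose (b * ?q + l)) = (a * ?q + k choose (b * ?q + l))
      + (if ?q \<le> b * ?q + l then a * ?q + k choose (b * ?q + l - ?q) else 0)] (mod p)"
    using prime_power_add_choose_cong[OF p, of u "a * ?q + k" "b * ?q + l"] by (simp add: add.assoc)
  show ?case
  proof (cases b)
    case 0
    with s assms(3) Suc.IH[of 0] show ?thesis by (auto intro: cong_trans)
  next
    case (Suc c)
    have "[(a * ?q + k choose (b * ?q + l)) + (a * ?q + k choose (c * ?q + l))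
       = (a choose b) * (k choose l) + (a choose c) * (k choose l)] (mod p)"
      by (intro cong_add Suc.IH)
    moreover have "b * ?q + l - ?q = c * ?q + l" "?q \<le> b * ?q + l" using Suc by auto
    ultimately show ?thesis using s Suc
      by (auto intro: cong_trans simp: algebra_simps)
  qed
qed

lemma of_nat_lucas:
  assumes "CHAR('a::comm_ring_1) = p" "prime p" "k < p ^ u" "l < p ^ u"
  shows "(of_nat (a * p ^ u + k choose (b * p ^ u + l)) :: 'a) = of_nat (a choose b) * of_nat (k choose l)"
  using lucas_prime_power[OF assms(2-4), of a b] assms(1)
  by (metis of_nat_eq_iff_cong_CHAR of_nat_mult)


text \<open>In characteristic \<open>p\<close> the lower digits of \<open>m\<close> enter products
  of basis elements at multiples of \<open>p ^ u\<close> only through this element.\<close>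

definition sZ :: "nat \<Rightarrow> nat \<Rightarrow> nat \<Rightarrow> 'a::comm_ring_1 salg" where
  "sZ p m u = (\<Sum>k\<in>{0<..<p ^ u}. of_nat (m mod p ^ u choose (p ^ u - k)) * sb k)"

lemma eq_mult_add_iff:
  fixes h q :: nat
  assumes "k < q"
  shows "h = a * q + k \<longleftrightarrow> h div q = a \<and> h mod q = k"
  using assms by (metis add.commute add.right_neutral div_less div_mult_mod_eq div_mult_self3 mod_less mod_mult_self3 not_less_zero)

text \<open>By Lucas the coefficient at \<open>a * p ^ u + k\<close> contains the factor
  \<open>k choose i\<close> with \<open>k \<le> i\<close>, hence only \<open>k = i\<close>
  survives.\<close>

lemma sb_mult_sb_less:
  assumes "CHAR('a::comm_ring_1) = p" "prime p" "i < p ^ u"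
  shows "sb (a * p ^ u) * sb i = (sb (a * p ^ u + i) :: 'a salg)"
proof (rule salg_eqI)
  fix m h
  let ?q = "p ^ u"
  have q: "0 < ?q" using assms by linarith
  show "coef (sb (a * ?q) * sb i :: 'a salg) m h = coef (sb (a * ?q + i)) m h"
  proof (cases "a * ?q \<le> h \<and> h \<le> a * ?q + i")
    case False
    then show ?thesis by (auto simp: coef_sb_mult scoef_eq_0)
  next
    case True
    then obtain k where k: "h = a * ?q + k" "k \<le> i" by (metis le_Suc_ex nat_add_left_cancel_le)
    have "(of_nat (h choose (a * ?q)) :: 'a) = 1"
      using of_nat_lucas[OF assms(1,2), of k u 0 a a] k assms(3) q by simp
    moreover have "(of_nat (h choose i) :: 'a) = of_nat (k choose i)"
      using of_nat_lucas[OF assms(1,2), of k u i a 0] k assms(3) by simp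
    ultimately show ?thesis
      using k by (cases "k = i") (auto simp: coef_sb_mult scoef_eq binomial_eq_0)
  qed
qed

lemma coef_sb_mult_sZ:
  assumes "CHAR('a::comm_ring_1) = p" "prime p"
  shows "coef (sb (a * p ^ u) * sZ p m u :: 'a salg) n h
    = (if h div p ^ u = a \<and> h mod p ^ u \<noteq> 0
       then of_nat (m mod p ^ u choose (p ^ u - h mod p ^ u)) else 0)"
proof -
  let ?q = "p ^ u"
  let ?c = "\<lambda>k. m mod ?q choose (?q - k)"
  have q: "0 < ?q" using assms prime_gt_0_nat by simp
  have "sb (a * ?q) * sZ p m u = (\<Sum>k\<in>{0<..<?q}. of_nat (?c k) * (sb (a * ?q) * sb k) :: 'a salg)"
    by (simp add: sZ_def sum_distrib_left mult.left_commute)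
  also have "\<dots> = (\<Sum>k\<in>{0<..<?q}. of_nat (?c k) * sb (a * ?q + k))"
    by (intro sum.cong refl) (simp add: sb_mult_sb_less[OF assms])
  finally have "coef (sb (a * ?q) * sZ p m u :: 'a salg) n h
      = (\<Sum>k\<in>{0<..<?q}. of_nat (?c k) * (if h = a * ?q + k then 1 else 0))" by simp
  also have "\<dots> = (\<Sum>k\<in>{0<..<?q}. if h mod ?q = k then (if h div ?q = a then of_nat (?c k) else 0) else 0)"
  proof (intro sum.cong refl)
    fix k assume "k \<in> {0<..<?q}"
    then have "h = a * ?q + k \<longleftrightarrow> h div ?q = a \<and> h mod ?q = k"
      by (simp add: eq_mult_add_iff)
    then show "of_nat (?c k) * (if h = a * ?q + k then 1 else 0)
       = (if h mod ?q = k then (if h div ?q = a then of_nat (?c k) else 0) else (0::'a))" by simp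
  qed
  also have "\<dots> = (if h div ?q = a \<and> h mod ?q \<noteq> 0 then of_nat (?c (h mod ?q)) else 0)"
    using q by (simp add: sum.delta)
  finally show ?thesis .
qed

text \<open>In the subtraction \<open>i * p ^ u + j * p ^ u - h\<close> a nonzero low part
  \<open>k\<close> of \<open>h\<close> forces a borrow. It causes the \<open>- 1\<close> in the
  quotient and the remainder \<open>p ^ u - k\<close>, whose binomial is a coefficient of
  \<open>sZ\<close>.\<close>

lemma of_nat_scoef_multiples:
  assumes "CHAR('a::comm_ring_1) = p" "prime p" "k < p ^ u"
  shows "(of_nat (scoef m (i * p ^ u) (j * p ^ u) (a * p ^ u + k)) :: 'a) =
    (if k = 0 then if a \<le> i + j then of_nat ((a choose i) * (a choose j) * (m div p ^ u + i + j choose (i + j - a))) else 0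
     else if a < i + j then of_nat ((a choose i) * (a choose j) * (m div p ^ u + i + j choose (i + j - a - 1)))
        * of_nat (m mod p ^ u choose (p ^ u - k)) else 0)"
proof -
  let ?q = "p ^ u"
  have q: "0 < ?q" using assms by linarith
  have c: "(of_nat (a * ?q + k choose (b * ?q)) :: 'a) = of_nat (a choose b)" for b
    using of_nat_lucas[OF assms, of 0 a b] q by simp
  have m: "m + i * ?q + j * ?q = (m div ?q + i + j) * ?q + m mod ?q"
    by (simp add: algebra_simps)
  have mm: "m mod ?q < ?q" using q by simp
  show ?thesis
  proof (cases "k = 0")
    case True
    show ?thesis
    proof (cases "a \<le> i + j")
      case le: True
      have e: "i * ?q + j * ?q - (a * ?q + k) = (i + j - a) * ?q + 0"
        using True by (simp add: algebra_simps diff_mult_distrib)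
      have "(of_nat (m + i * ?q + j * ?q choose (i * ?q + j * ?q - (a * ?q + k))) :: 'a)
         = of_nat (m div ?q + i + j choose (i + j - a))"
        unfolding m e using of_nat_lucas[OF assms(1,2) mm q] by simp
      moreover have "a * ?q + k \<le> i * ?q + j * ?q"
        using True le by (metis add.right_neutral add_mult_distrib mult_le_mono1)
      ultimately show ?thesis using True le c[of i] c[of j] by (simp add: scoef_eq)
    next
      case False
      then have "i * ?q + j * ?q < a * ?q + k"
        using q by (metis add_mult_distrib linorder_not_le mult_less_mono1 trans_less_add1)
      with True False show ?thesis by (simp add: scoef_eq)
    qed
  next
    case False
    show ?thesis
    proof (cases "a < i + j")
      case lt: True
      then obtain d where d: "i + j = Suc a + d" by (metis Suc_leI le_Suc_ex)
      have ij: "i * ?q + j * ?q = (Suc a + d) * ?q" using d by (metis add_mult_distrib)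
      have e: "i * ?q + j * ?q - (a * ?q + k) = (i + j - a - 1) * ?q + (?q - k)"
        unfolding ij d using assms(3) by (simp add: algebra_simps)
      have "(of_nat (m + i * ?q + j * ?q choose (i * ?q + j * ?q - (a * ?q + k))) :: 'a)
         = of_nat (m div ?q + i + j choose (i + j - a - 1)) * of_nat (m mod ?q choose (?q - k))"
        unfolding m e using of_nat_lucas[OF assms(1,2) mm, of "?q - k"] False q by simp
      moreover have "a * ?q + k \<le> i * ?q + j * ?q"
        unfolding ij using assms(3) by (simp add: algebra_simps)
      ultimately show ?thesis using False lt by (simp add: scoef_eq c)
    next
      case ge: False
      then have "(i + j) * ?q \<le> a * ?q" by (intro mult_le_mono1) simp
      then have "i * ?q + j * ?q < a * ?q + k" using False by (simp add: add_mult_distrib)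
      with ge False show ?thesis by (simp add: scoef_eq)
    qed
  qed
qed

text \<open>The structure constants depend on \<open>m\<close>, hence the restriction to the
  component \<open>m\<close>. Terms without a borrow are multiples of \<open>sb (a * p ^ u)\<close>,
  those with a borrow are multiples of its product with \<open>sZ\<close>.\<close>

lemma sb_multiples_mult:
  assumes "CHAR('a::comm_ring_1) = p" "prime p"
  shows "scomp m 1 * (sb (i * p ^ u) * sb (j * p ^ u)) = (scomp m 1 * (\<Sum>a\<le>i + j.
     of_nat ((a choose i) * (a choose j)) *
       (of_nat (m div p ^ u + i + j choose (i + j - a)) * sb (a * p ^ u)
      + of_nat (if a < i + j then m div p ^ u + i + j choose (i + j - a - 1) else 0) * (sb (a * p ^ u) * sZ p m u))) :: 'a salg)"
    (is "_ = _ * sum ?g _")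
proof (rule salg_eqI)
  fix n h
  let ?q = "p ^ u"
  have q: "0 < ?q" using assms prime_gt_0_nat by simp
  define a where "a = h div ?q"
  define k where "k = h mod ?q"
  have k: "k < ?q" using q by (simp add: k_def)
  then have h: "h = a * ?q + k" by (simp add: eq_mult_add_iff a_def k_def)
  have hb: "h = b * ?q \<longleftrightarrow> a = b \<and> k = 0" for b
    using q by (auto simp: a_def k_def)
  note S = of_nat_scoef_multiples[OF assms k, of m i j a, folded h]
  have "coef (sum ?g {..i+j}) m h = (\<Sum>b\<le>i+j. if a = b then of_nat (scoef m (i * ?q) (j * ?q) h) else 0)"
    unfolding coef_sum
  proof (intro sum.cong refl)
    fix b assume "b \<in> {..i + j}"
    then show "coef (?g b) m h = (if a = b then of_nat (scoef m (i * ?q) (j * ?q) h) else 0)"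
      unfolding S by (cases "a = b"; cases "k = 0")
        (auto simp: coef_sb_mult_sZ[OF assms] hb a_def[symmetric] k_def[symmetric] mult.assoc)
  qed
  also have "\<dots> = of_nat (scoef m (i * ?q) (j * ?q) h)"
    unfolding S by simp
  finally show "coef (scomp m 1 * (sb (i * ?q) * sb (j * ?q)) :: 'a salg) n h = coef (scomp m 1 * sum ?g {..i+j}) n h"
    by (simp add: coef_sb_mult del: coef_sum)
qed

text \<open>Split the index \<open>h = a * p ^ u + k\<close> at digit \<open>u\<close>: for
  \<open>k = 0\<close> the digit of \<open>m\<close> contributes alone; for \<open>k > 0\<close>
  there is a borrow, and the lower digits reproduce \<open>sZ p m u\<close>.\<close>

lemma sZ_Suc:
  assumes "CHAR('a::comm_ring_1) = p" "prime p"
  defines "d \<equiv> \<lambda>m u. m div p ^ u mod p"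
  shows "sZ p m (Suc u) = (\<Sum>a<p. of_nat (d m u choose (p - a)) * sb (a * p ^ u)
     + of_nat (d m u choose (p - 1 - a)) * (sb (a * p ^ u) * sZ p m u) :: 'a salg)"
    (is "_ = sum ?g _")
proof (rule salg_eqI)
  fix n h
  let ?q = "p ^ u"
  have p: "0 < p" and q: "0 < ?q" using assms prime_gt_0_nat by simp_all
  define a where "a = h div ?q"
  define k where "k = h mod ?q"
  have k: "k < ?q" using q by (simp add: k_def)
  then have h: "h = a * ?q + k" by (simp add: eq_mult_add_iff a_def k_def)
  have hb: "h = b * ?q \<longleftrightarrow> a = b \<and> k = 0" for b
    using q by (auto simp: a_def k_def)
  have mod: "m mod p ^ Suc u = d m u * ?q + m mod ?q"
    using mod_mult2_eq[of m ?q p] by (simp add: d_def mult.commute)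
  have mm: "m mod ?q < ?q" using q by simp
  have ap: "a < p \<longleftrightarrow> h < p ^ Suc u"
    using q by (simp add: a_def div_less_iff_less_mult mult.commute)
  have "coef (sZ p m (Suc u) :: 'a salg) n h = coef (sb (0 * p ^ Suc u) * sZ p m (Suc u) :: 'a salg) n h"
    by (simp add: sb_0)
  also have "\<dots> = (if a < p \<and> h \<noteq> 0 then of_nat (m mod p ^ Suc u choose (p ^ Suc u - h)) else 0)"
    unfolding coef_sb_mult_sZ[OF assms(1,2)] using p q by (auto simp: ap div_eq_0_iff simp del: power_Suc)
  finally have L: "coef (sZ p m (Suc u) :: 'a salg) n h = (if a < p \<and> h \<noteq> 0 then of_nat (m mod p ^ Suc u choose (p ^ Suc u - h)) else 0)" .
  have "coef (sum ?g {..<p}) n h = (\<Sum>b<p. if a = b then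
      (if k = 0 then of_nat (d m u choose (p - b)) else of_nat (d m u choose (p - 1 - b)) * of_nat (m mod ?q choose (?q - k))) else 0)"
    unfolding coef_sum
    by (intro sum.cong refl)
       (auto simp: coef_sb_mult_sZ[OF assms(1,2)] hb a_def[symmetric] k_def[symmetric])
  also have "\<dots> = (if a < p then (if k = 0 then of_nat (d m u choose (p - a)) else of_nat (d m u choose (p - 1 - a)) * of_nat (m mod ?q choose (?q - k))) else 0)"
    by simp
  also have "\<dots> = coef (sZ p m (Suc u) :: 'a salg) n h"
  proof (cases "a < p")
    case True
    then obtain c where c: "p = Suc a + c" by (metis Suc_leI le_Suc_ex)
    show ?thesis
    proof (cases "k = 0")
      case k0: True
      have "p ^ Suc u - h = (p - a) * ?q + 0" using h k0 by (simp add: diff_mult_distrib)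
      then have "(of_nat (m mod p ^ Suc u choose (p ^ Suc u - h)) :: 'a) = of_nat (d m u choose (p - a))"
        unfolding mod using of_nat_lucas[OF assms(1,2) mm q, of "d m u" "p - a"] by simp
      \<comment> \<open>This settles \<open>h = 0\<close>, which \<open>sZ\<close> omits: the term
        for \<open>a = 0\<close> is zero because the digit is below \<open>p\<close>.\<close>
      moreover have "d m u choose p = 0" using p by (intro binomial_eq_0) (simp add: d_def)
      ultimately show ?thesis using True k0 q L h by (auto simp: binomial_eq_0)
    next
      case False
      have "p ^ Suc u - h = (p - 1 - a) * ?q + (?q - k)"
        using h k c by (simp add: algebra_simps)
      then have "(of_nat (m mod p ^ Suc u choose (p ^ Suc u - h)) :: 'a)
          = of_nat (d m u choose (p - 1 - a)) * of_nat (m mod ?q choose (?q - k))"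
        unfolding mod using of_nat_lucas[OF assms(1,2) mm, of "?q - k" "d m u" "p - 1 - a"] False q by simp
      then show ?thesis using True False L h by auto
    qed
  qed (simp add: L)
  finally show "coef (sZ p m (Suc u) :: 'a salg) n h = coef (sum ?g {..<p}) n h" ..
qed


section \<open>The factors in characteristic 3\<close>

definition sfac :: "nat \<Rightarrow> nat \<Rightarrow> 'r \<Rightarrow> 'r \<Rightarrow> 'r::comm_ring_1" where
  "sfac g n b1 b2 =
     (if g = 0 \<and> n = 0 then 1 + b1 - b2
      else if g = 1 \<and> n = 2 then b2 - b1
      else if g = 0 \<and> n = 1 then 1 - b2
      else if g = 2 \<and> n = 2 then b2
      else if g = 0 \<and> n = 2 then 1 - b1 + b2
      else if g = 1 \<and> n = 1 then b1 - b2
      else 1)"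

text \<open>The relations between \<open>b1 = b(3^u)\<close> and \<open>b2 = b(2 * 3^u)\<close> on a common eigenvector \<open>E\<close>, with
  \<open>s\<close> the sum modulo 3 of the digit \<open>m_u\<close> and the carry.\<close>

definition srel :: "'r::comm_ring_1 \<Rightarrow> 'r \<Rightarrow> 'r \<Rightarrow> nat \<Rightarrow> bool" where
  "srel E b1 b2 s \<longleftrightarrow> E * b1 * b1 = (of_nat s - 1) * (E * b1) + E * b2 \<and>
     E * b1 * b2 = - of_nat s * (E * b2) \<and> E * b2 * b2 = (if s = 1 then E * b2 else 0)"

text \<open>Rewrite rules that bring integer multiples to coefficients 0, 1 and -1; the rule with
  \<open>y\<close> catches repeated summands inside an ordered sum.\<close>

lemma char3_simps:
  assumes "(3::'r::comm_ring_1) = 0"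
  shows "(2::'r) = -1" "(4::'r) = 1" "x + x = - (x::'r)" "x + (x + y) = y - (x::'r)" "- x - x = (x::'r)"
proof -
  have "(2::'r) = 3 - 1" "(4::'r) = 3 + 1" by simp_all
  then show two: "(2::'r) = -1" "(4::'r) = 1" using assms by simp_all
  show "x + x = - x" using two(1) mult_2[of x] by simp
  then show "x + (x + y) = y - x" by (metis add.assoc add.commute uminus_add_conv_diff)
  show "- x - x = x" using \<open>x + x = - x\<close> by (metis add_uminus_conv_diff minus_add_distrib minus_minus)
qed

lemma srel_cases:
  assumes "srel E b1 b2 s" "(3::'r::comm_ring_1) = 0" "s < 3"
  obtains "s = 0" "(E::'r) * b1 * b1 = E * b2 - E * b1" "E * b1 * b2 = 0" "E * b2 * b2 = 0"
   "E * b2 * b1 = 0"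
  | "s = 1" "E * b1 * b1 = E * b2" "E * b1 * b2 = - (E * b2)" "E * b2 * b2 = E * b2" "E * b2 * b1 = - (E * b2)"
  | "s = 2" "E * b1 * b1 = E * b1 + E * b2" "E * b1 * b2 = E * b2" "E * b2 * b2 = 0" "E * b2 * b1 = E * b2"
proof -
  have c: "E * b2 * b1 = E * b1 * b2" by (simp add: ac_simps)
  consider "s = 0" | "s = 1" | "s = 2" using assms(3) by linarith
  then show ?thesis
    using assms(1) that c by cases (simp_all add: srel_def char3_simps[OF assms(2)])
qed

text \<open>The condition \<open>g \<le> (s + 2 * g) mod 3\<close> leaves two digits for each
  \<open>s\<close>: 0 and 1 for \<open>s = 0\<close>, 0 and 2 for \<open>s = 1\<close>, 0 and 1 for
  \<open>s = 2\<close>. In each case expansion and the relations reduce the square.\<close>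

lemma sfac_idem:
  assumes "srel E b1 b2 s" "(3::'r::comm_ring_1) = 0" "s < 3" "g < 3" "g \<le> (s + 2 * g) mod 3"
  shows "(E::'r) * sfac g ((s + 2 * g) mod 3) b1 b2 * sfac g ((s + 2 * g) mod 3) b1 b2
      = E * sfac g ((s + 2 * g) mod 3) b1 b2"
proof -
  consider "g = 0" | "g = 1" | "g = 2" using assms(4) by linarith
  then show ?thesis
    using assms(5) by (cases rule: srel_cases[OF assms(1-3)]; cases) 
     (simp_all add: sfac_def distrib_left distrib_right left_diff_distrib right_diff_distrib mult.assoc[symmetric] char3_simps[OF assms(2)] add_ac)
qed

lemma sfac_orth:
  assumes "srel E b1 b2 s" "(3::'r::comm_ring_1) = 0" "s < 3" "g < 3" "g \<le> (s + 2 * g) mod 3"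
    "g' < 3" "g' \<le> (s + 2 * g') mod 3" "g \<noteq> g'"
  shows "(E::'r) * sfac g ((s + 2 * g) mod 3) b1 b2 * sfac g' ((s + 2 * g') mod 3) b1 b2 = 0"
proof -
  consider "g = 0" "g' = 1" | "g = 0" "g' = 2" | "g = 1" "g' = 0" | "g = 2" "g' = 0" | "g = 1" "g' = 2" | "g = 2" "g' = 1"
    using assms(4,6,8) by linarith
  then show ?thesis
    using assms(5,7) by (cases rule: srel_cases[OF assms(1-3)]; cases) 
     (simp_all add: sfac_def distrib_left distrib_right left_diff_distrib right_diff_distrib mult.assoc[symmetric] char3_simps[OF assms(2)] add_ac)
qed

text \<open>For each \<open>s\<close> the two admissible factors have the form \<open>1 - x\<close>
  and \<open>x\<close>.\<close>

lemma sfac_sum: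
  assumes "s < 3"
  shows "(\<Sum>g<3. if g \<le> (s + 2 * g) mod 3 then sfac g ((s + 2 * g) mod 3) b1 b2 else 0) = (1::'r::comm_ring_1)"
proof -
  have i: "{..<3::nat} = {0,1,2}" by auto
  consider "s = 0" | "s = 1" | "s = 2" using assms by linarith
  then show ?thesis by cases (simp_all add: sfac_def i)
qed

lemma sfac_cube:
  assumes "srel E b1 b2 s" "(3::'r::comm_ring_1) = 0" "s < 3" "g < 3" "g \<le> (s + 2 * g) mod 3"
  shows "\<exists>k. (E::'r) * sfac g ((s + 2 * g) mod 3) b1 b2 * b1 * b1 * b1
      = of_nat k * (E * sfac g ((s + 2 * g) mod 3) b1 b2)"
    and "\<exists>k. (E::'r) * sfac g ((s + 2 * g) mod 3) b1 b2 * b2 * b2 * b2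
      = of_nat k * (E * sfac g ((s + 2 * g) mod 3) b1 b2)"
proof -
  let ?f = "sfac g ((s + 2 * g) mod 3) b1 b2"
  consider "g = 0" | "g = 1" | "g = 2" using assms(4) by linarith
  then have "E * ?f * b1 * b1 * b1 \<in> {0, E * ?f, - (E * ?f)} \<and> E * ?f * b2 * b2 * b2 \<in> {0, E * ?f, - (E * ?f)}"
    using assms(5) by (cases rule: srel_cases[OF assms(1-3)]; cases) 
     (simp_all add: sfac_def distrib_left distrib_right left_diff_distrib right_diff_distrib mult.assoc[symmetric] char3_simps[OF assms(2)] add_ac)
  \<comment> \<open>The scalar -1 is the natural number 2 in characteristic 3.\<close>
  moreover have "of_nat 2 * x = - x" for x :: 'r by (simp add: char3_simps[OF assms(2)])
  ultimately show "\<exists>k. E * ?f * b1 * b1 * b1 = of_nat k * (E * ?f)" "\<exists>k. E * ?f * b2 * b2 * b2 = of_nat k * (E * ?f)"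
    by (metis insert_iff singletonD of_nat_0 of_nat_1 mult_zero_left mult_1)+
qed

text \<open>The bracket is \<open>sZ\<close> at the next level, as in \<open>sZ_Suc_3\<close>, with
  the previous \<open>sZ\<close> replaced by its eigenvalue \<open>c\<close>; the new eigenvalue is
  the outgoing carry. That carry is at most 1: a sum of 6 or 7 would need \<open>g = 2\<close>, but
  its residue 0 or 1 is then smaller than \<open>g\<close>.\<close>

lemma sfac_carry:
  assumes "srel E b1 b2 ((d + c) mod 3)" "(3::'r::comm_ring_1) = 0" "g < 3" "g \<le> (d + c + 2 * g) mod 3" "d < 3" "c < 2"
  shows "(E::'r) * sfac g ((d + c + 2 * g) mod 3) b1 b2 *
    (of_nat (d choose 2) * b1 + of_nat d * b2 + of_nat c * (of_nat (d choose 2) + of_nat d * b1 + b2))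
      = of_nat ((d + c + 2 * g) div 3) * (E * sfac g ((d + c + 2 * g) mod 3) b1 b2)"
    and "(d + c + 2 * g) div 3 < 2"
proof -
  have "g = 0 \<or> g = 1 \<or> g = 2" "(d = 0 \<or> d = 1 \<or> d = 2)" "c = 0 \<or> c = 1"
    using assms by linarith+
  then have "(E * sfac g ((d + c + 2 * g) mod 3) b1 b2 *
    (of_nat (d choose 2) * b1 + of_nat d * b2 + of_nat c * (of_nat (d choose 2) + of_nat d * b1 + b2))
      = of_nat ((d + c + 2 * g) div 3) * (E * sfac g ((d + c + 2 * g) mod 3) b1 b2)) \<and> (d + c + 2 * g) div 3 < 2"
    using assms(4) by (cases rule: srel_cases[OF assms(1,2) mod_less_divisor[OF zero_less_numeral]]; elim disjE)
     (simp_all add: sfac_def binomial_eq_0 distrib_left distrib_right left_diff_distrib right_diff_distrib mult.assoc[symmetric] char3_simps[OF assms(2)] add_ac)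
  then show "(E::'r) * sfac g ((d + c + 2 * g) mod 3) b1 b2 *
    (of_nat (d choose 2) * b1 + of_nat d * b2 + of_nat c * (of_nat (d choose 2) + of_nat d * b1 + b2))
      = of_nat ((d + c + 2 * g) div 3) * (E * sfac g ((d + c + 2 * g) mod 3) b1 b2)"
    and "(d + c + 2 * g) div 3 < 2" by blast+
qed


section \<open>Digits, carries and partial products in base 3\<close>

lemma salg_three_eq_0:
  assumes "CHAR('a::comm_ring_1) = 3"
  shows "(3 :: 'a salg) = 0"
proof -
  have "(of_nat 3 :: 'a) = 0" using assms by (metis of_nat_CHAR)
  then have "(of_nat 3 :: 'a salg) = 0" by (intro salg_eqI) (simp add: coef_of_nat del: of_nat_numeral)
  then show ?thesis by simp
qed

lemma of_nat_mod_3: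
  assumes "(3 :: 'r::comm_ring_1) = 0"
  shows "(of_nat (n mod 3) :: 'r) = of_nat n"
proof -
  have "(of_nat n :: 'r) = of_nat (3 * (n div 3) + n mod 3)" by simp
  also have "\<dots> = of_nat (n mod 3)" using assms by (simp only: of_nat_add of_nat_mult of_nat_numeral) simp
  finally show ?thesis ..
qed

definition sE :: "nat \<Rightarrow> nat \<Rightarrow> nat \<Rightarrow> 'a::comm_ring_1 salg" where
  "sE m n g = scomp m 1 * (\<Prod>u<n. sfac (digit3 g u) (digit3 (m + 2 * g) u) (sb (3 ^ u)) (sb (2 * 3 ^ u)))"

lemma sE_0 [simp]: "sE m 0 g = scomp m 1" by (simp add: sE_def)

lemma sE_Suc: "sE m (Suc n) g = sE m n g * sfac (digit3 g n) (digit3 (m + 2 * g) n) (sb (3 ^ n)) (sb (2 * 3 ^ n))"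
  by (simp add: sE_def mult.assoc)

lemma scomp_mult_sE: "scomp m 1 * sE m n g = sE m n g"
  by (simp add: sE_def mult.assoc[symmetric] scomp_mult)

text \<open>The carry into digit \<open>n\<close> when \<open>2 * g\<close> is added to
  \<open>m\<close>. Since \<open>g\<close> is doubled within the same addition, it can be 2 in
  general; \<open>valid3\<close> keeps it below 2.\<close>

definition carry3 :: "nat \<Rightarrow> nat \<Rightarrow> nat \<Rightarrow> nat" where
  "carry3 m n g = (m mod 3 ^ n + 2 * (g mod 3 ^ n)) div 3 ^ n"

lemma digit3_less: "digit3 g n < 3" by (simp add: digit3_def)

lemma digit3_add_double:
  "digit3 (m + 2 * g) n = (digit3 m n + carry3 m n g + 2 * digit3 g n) mod 3"
proof -
  let ?q = "3 ^ n :: nat"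
  have "m + 2 * g = (m div ?q * ?q + m mod ?q) + 2 * (g div ?q * ?q + g mod ?q)"
    by (simp only: div_mult_mod_eq)
  also have "\<dots> = (m div ?q + 2 * (g div ?q)) * ?q + (m mod ?q + 2 * (g mod ?q))"
    by (simp only: distrib_left distrib_right mult.assoc add_ac)
  finally have "(m + 2 * g) div ?q = m div ?q + 2 * (g div ?q) + carry3 m n g"
    by (simp add: carry3_def)
  then have "digit3 (m + 2 * g) n = (m div ?q + carry3 m n g + 2 * (g div ?q)) mod 3"
    by (simp add: digit3_def ac_simps)
  moreover have "(x + c + 2 * y) mod 3 = (x mod 3 + c + 2 * (y mod 3)) mod 3" for x y c :: nat
    by (intro mod_add_cong mod_mult_cong) simp_all
  ultimately show ?thesis by (simp only: digit3_def)
qed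

lemma mod_3_power_Suc: "m mod 3 ^ Suc n = digit3 m n * 3 ^ n + m mod 3 ^ n"
  using mod_mult2_eq[of m "3 ^ n" 3] by (simp add: digit3_def mult.commute)

lemma carry3_Suc: "carry3 m (Suc n) g = (digit3 m n + carry3 m n g + 2 * digit3 g n) div 3"
proof -
  let ?q = "3 ^ n :: nat"
  have "m mod 3 ^ Suc n + 2 * (g mod 3 ^ Suc n)
     = (digit3 m n + 2 * digit3 g n) * ?q + (m mod ?q + 2 * (g mod ?q))"
    unfolding mod_3_power_Suc by (simp add: algebra_simps)
  then have "(m mod 3 ^ Suc n + 2 * (g mod 3 ^ Suc n)) div ?q = digit3 m n + 2 * digit3 g n + carry3 m n g"
    by (simp add: carry3_def)
  moreover have "carry3 m (Suc n) g = (m mod 3 ^ Suc n + 2 * (g mod 3 ^ Suc n)) div ?q div 3"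
    by (simp add: carry3_def div_mult2_eq[symmetric] mult.commute)
  ultimately show ?thesis by (simp add: ac_simps)
qed

text \<open>Lucas' criterion for \<open>Bmg m g\<close> to be prime to 3, tested on the lowest
  \<open>n\<close> digits.\<close>

definition valid3 :: "nat \<Rightarrow> nat \<Rightarrow> nat \<Rightarrow> bool" where
  "valid3 m n g \<longleftrightarrow> (\<forall>u<n. digit3 g u \<le> digit3 (m + 2 * g) u)"

lemma valid3_Suc: "valid3 m (Suc n) g \<longleftrightarrow> valid3 m n g \<and> digit3 g n \<le> digit3 (m + 2 * g) n"
  by (auto simp: valid3_def less_Suc_eq)

text \<open>Multiply by \<open>sb_multiples_mult\<close>, replace \<open>sZ\<close> by its
  eigenvalue \<open>c\<close>, and reduce the coefficients modulo 3.\<close>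

lemma srel_of_carry:
  fixes E :: "'a::comm_ring_1 salg"
  assumes char: "CHAR('a) = 3" and D: "scomp m 1 * E = E"
    and Z: "E * sZ 3 m n = of_nat c * E" and c: "c < 2"
  shows "srel E (sb (3 ^ n)) (sb (2 * 3 ^ n)) ((digit3 m n + c) mod 3)"
proof -
  let ?q = "3 ^ n :: nat"
  let ?b1 = "sb ?q :: 'a salg" and ?b2 = "sb (2 * ?q) :: 'a salg" and ?Z = "sZ 3 m n :: 'a salg"
  define M where "M = m div ?q"
  note three = salg_three_eq_0[OF char]
  note red = of_nat_mod_3[OF three]
  have p: "prime (3::nat)" by simp
  \<comment> \<open>Identities known only on the component \<open>m\<close> may be used next to
    \<open>E\<close>, since \<open>E\<close> lies in that component.\<close>
  have step: "E * x = E * y" if "scomp m 1 * x = scomp m 1 * y" for x y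
  proof -
    have "E * x = E * (scomp m 1 * x)" for x by (subst D[symmetric]) (simp only: ac_simps)
    then show ?thesis using that by metis
  qed
  have i: "{..2} = {0,1,2::nat}" "{..3} = {0,1,2,3::nat}" "{..4} = {0,1,2,3,4::nat}" by auto
  have Zb: "E * (b * ?Z) = of_nat c * (E * b)" for b
  proof -
    have "E * (b * ?Z) = (E * ?Z) * b" by (simp only: ac_simps)
    then show ?thesis by (simp only: Z ac_simps)
  qed
  have Zb2: "E * (a * (b * ?Z)) = of_nat c * (E * (a * b))" for a b
    using Zb[of "a * b"] by (simp only: mult.assoc)
  have ch: "(2::nat) choose 2 = 1" "(3::nat) choose 2 = 3" "(4::nat) choose 2 = 6" "0 choose 2 = (0::nat)" "1 choose 2 = (0::nat)"
    "Suc 0 choose 2 = 0" "Suc (Suc 0) choose 2 = 1" "Suc (Suc (Suc 0)) choose 2 = 3"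
    by (simp_all add: choose_two)
  have four: "Suc (Suc (Suc (Suc x))) = x + 4" for x by simp
  have tw: "3 ^ n + 3 ^ n = 2 * (3 ^ n :: nat)" by simp
  \<comment> \<open>9 and 36 are the coefficients of the basis elements at \<open>3 * ?q\<close> and
    \<open>4 * ?q\<close>, which therefore drop out of the products.\<close>
  have "(36::'a salg) = 3 * 12" "(9::'a salg) = 3 * 3" by simp_all
  then have z: "(36::'a salg) = 0" "(9::'a salg) = 0" by (simp_all only: three mult_zero_left)
  have "E * (?b1 * ?b1) = E * (of_nat (M + 2) * ?b1 + ?b1 * ?Z + 4 * ?b2)"
    using sb_multiples_mult[OF char p, of m 1 n 1] by (intro step) (simp add: M_def i ch tw)
  then have 1: "E * ?b1 * ?b1 = of_nat (M + 2 + c) * (E * ?b1) + E * ?b2"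
    by (simp add: distrib_left distrib_right left_diff_distrib right_diff_distrib Zb char3_simps[OF three] mult.assoc mult.left_commute)
  have "E * (?b1 * ?b2) = E * (2 * ((3 + of_nat M) * ?b2 + ?b2 * ?Z))"
    using sb_multiples_mult[OF char p, of m 1 n 2]
    by (intro step) (simp add: M_def i ch tw z)
  then have 2: "E * ?b1 * ?b2 = - of_nat (M + c) * (E * ?b2)"
    using three by (simp add: distrib_left distrib_right left_diff_distrib right_diff_distrib Zb char3_simps[OF three] mult.assoc mult.left_commute)
  have "E * (?b2 * ?b2) = E * (of_nat (M + 4 choose 2) * ?b2 + (of_nat M + 4) * (?b2 * ?Z))"
    using sb_multiples_mult[OF char p, of m 2 n 2]
    by (intro step) (simp add: M_def i ch tw z four)
  then have 3: "E * ?b2 * ?b2 = of_nat ((M + 4 choose 2) + (M + 4) * c) * (E * ?b2)"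
    by (simp add: distrib_left distrib_right Zb Zb2 mult.assoc mult.left_commute)
  let ?s = "(digit3 m n + c) mod 3"
  have d: "digit3 m n = M mod 3" by (simp add: digit3_def M_def)
  have s: "?s = (M + c) mod 3" unfolding d by (rule mod_add_left_eq)
  have e1: "(of_nat (M + 2 + c) :: 'a salg) = of_nat ?s - 1"
    unfolding s red by (simp add: char3_simps[OF three])
  have e2: "(of_nat (M + c) :: 'a salg) = of_nat ?s" unfolding s red ..
  \<comment> \<open>Lucas reduces \<open>M + 4\<close> modulo 3; then \<open>c < 2\<close> leaves
    six cases of \<open>M mod 3\<close> and \<open>c\<close> to check.\<close>
  have e3: "(of_nat ((M + 4 choose 2) + (M + 4) * c) :: 'a salg) = (if ?s = 1 then 1 else 0)"
  proof -
    let ?y = "(M + 4) mod 3"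
    have "[(M + 4 choose 2) = ?y choose 2] (mod 3)"
      using lucas_prime_power[OF p, of ?y 1 2 "(M + 4) div 3" 0] by (simp add: numeral_2_eq_2)
    then have "[(M + 4 choose 2) + (M + 4) * c = (?y choose 2) + ?y * c] (mod 3)"
      by (intro cong_add cong_mult) simp_all
    moreover have "((?y choose 2) + ?y * c) mod 3 = (if ?s = 1 then 1 else 0)"
    proof -
      consider "M mod 3 = 0" | "M mod 3 = 1" | "M mod 3 = 2" by linarith
      moreover have "?y = (M mod 3 + 1) mod 3" by presburger
      moreover have "c = 0 \<or> c = 1" using c by linarith
      ultimately show ?thesis unfolding d by cases (auto simp: ch)
    qed
    ultimately have "((M + 4 choose 2) + (M + 4) * c) mod 3 = (if ?s = 1 then 1 else 0)"
      by (simp add: cong_def)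
    then show ?thesis by (metis red of_nat_0 of_nat_1)
  qed
  show ?thesis unfolding srel_def 1 2 3 e1 e2 e3 by simp
qed

lemma sZ_Suc_3:
  assumes "CHAR('a::comm_ring_1) = 3"
  shows "sZ 3 m (Suc n) = of_nat (digit3 m n choose 2) * sb (3 ^ n) + of_nat (digit3 m n) * sb (2 * 3 ^ n)
    + (of_nat (digit3 m n choose 2) + of_nat (digit3 m n) * sb (3 ^ n) + sb (2 * 3 ^ n)) * (sZ 3 m n :: 'a salg)"
proof -
  have i: "{..<3} = {0,1,2::nat}" by auto
  show ?thesis
    using sZ_Suc[OF assms, of m n] by (simp add: binomial_eq_0 digit3_less i digit3_def[symmetric] sb_0 algebra_simps)
qed

text \<open>Bound and eigenvalue go through the induction together: \<open>srel\<close> at level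
  \<open>n\<close> needs both, and \<open>sfac_carry\<close> returns both at level
  \<open>n + 1\<close>.\<close>

lemma sE_sZ:
  assumes "CHAR('a::comm_ring_1) = 3" "valid3 m n g"
  shows "carry3 m n g < 2 \<and> (sE m n g :: 'a salg) * sZ 3 m n = of_nat (carry3 m n g) * sE m n g"
  using assms(2)
proof (induction n)
  case 0
  then show ?case by (simp add: carry3_def sZ_def)
next
  case (Suc n)
  let ?E = "sE m n g :: 'a salg"
  let ?d = "digit3 m n" and ?c = "carry3 m n g" and ?g = "digit3 g n"
  have v: "valid3 m n g" and le: "?g \<le> (?d + ?c + 2 * ?g) mod 3"
    using Suc.prems by (simp_all add: valid3_Suc digit3_add_double)
  note IH = Suc.IH[OF v]
  have r: "srel ?E (sb (3 ^ n)) (sb (2 * 3 ^ n)) ((?d + ?c) mod 3)"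
    by (rule srel_of_carry[OF assms(1) scomp_mult_sE conjunct2[OF IH] conjunct1[OF IH]])
  note C = sfac_carry[OF r salg_three_eq_0[OF assms(1)] digit3_less le digit3_less conjunct1[OF IH]]
  let ?f = "sfac ?g ((?d + ?c + 2 * ?g) mod 3) (sb (3 ^ n)) (sb (2 * 3 ^ n)) :: 'a salg"
  let ?Z = "sZ 3 m n :: 'a salg"
  have Zx: "?E * ?f * (x * ?Z) = ?E * ?f * (of_nat ?c * x)" for x
  proof -
    have "?E * ?f * (x * ?Z) = (?E * ?Z) * (?f * x)" by (simp only: ac_simps)
    then show ?thesis by (simp only: conjunct2[OF IH] ac_simps)
  qed
  have "?E * ?f * sZ 3 m (Suc n) = ?E * ?f * (of_nat (?d choose 2) * sb (3 ^ n) + of_nat ?d * sb (2 * 3 ^ n)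
     + of_nat ?c * (of_nat (?d choose 2) + of_nat ?d * sb (3 ^ n) + sb (2 * 3 ^ n)))"
    unfolding sZ_Suc_3[OF assms(1)] distrib_left[of "?E * ?f"] Zx ..
  then show ?case using C by (simp add: sE_Suc carry3_Suc digit3_add_double)
qed

lemma srel_sE:
  assumes "CHAR('a::comm_ring_1) = 3" "valid3 m n g"
  shows "srel (sE m n g :: 'a salg) (sb (3 ^ n)) (sb (2 * 3 ^ n)) ((digit3 m n + carry3 m n g) mod 3)"
  by (rule srel_of_carry[OF assms(1) scomp_mult_sE conjunct2[OF sE_sZ[OF assms]] conjunct1[OF sE_sZ[OF assms]]])


section \<open>Idempotency, orthogonality and sum of the partial products\<close>

lemma digit3_add_double':
  "digit3 (m + 2 * g) n = ((digit3 m n + carry3 m n g) mod 3 + 2 * digit3 g n) mod 3"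
  unfolding digit3_add_double by (simp add: mod_simps)

lemma sE_idem:
  assumes "CHAR('a::comm_ring_1) = 3" "valid3 m n g"
  shows "sE m n g * sE m n g = (sE m n g :: 'a salg)"
  using assms(2)
proof (induction n)
  case 0
  then show ?case by (simp add: scomp_mult)
next
  case (Suc n)
  let ?E = "sE m n g :: 'a salg"
  let ?f = "sfac (digit3 g n) (digit3 (m + 2 * g) n) (sb (3 ^ n)) (sb (2 * 3 ^ n)) :: 'a salg"
  have v: "valid3 m n g" and le: "digit3 g n \<le> digit3 (m + 2 * g) n"
    using Suc.prems by (simp_all add: valid3_Suc)
  have "?E * ?f * ?f = ?E * ?f"
    using sfac_idem[OF srel_sE[OF assms(1) v] salg_three_eq_0[OF assms(1)] _ digit3_less, of g n] le
    by (simp only: digit3_add_double'[symmetric])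
  moreover have "(?E * ?f) * (?E * ?f) = (?E * ?E) * ?f * ?f" by (simp only: ac_simps)
  ultimately show ?case using Suc.IH[OF v] by (simp only: sE_Suc)
qed

lemma digit3_eq_mod_div: "digit3 g u = g mod 3 ^ Suc u div 3 ^ u"
  unfolding mod_3_power_Suc by simp

lemma digit3_mod_cong:
  assumes "g mod 3 ^ n = g' mod 3 ^ n" "u < n"
  shows "digit3 g u = digit3 g' u"
proof -
  have "(3::nat) ^ Suc u dvd 3 ^ n" using assms(2) by (intro le_imp_power_dvd) simp
  then have "g mod 3 ^ Suc u = g' mod 3 ^ Suc u"
    using assms(1) by (metis mod_mod_cancel)
  then show ?thesis by (simp only: digit3_eq_mod_div)
qed

lemma mod_3_power_cong_add_double:
  assumes "g mod 3 ^ n = g' mod (3 ^ n :: nat)"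
  shows "(m + 2 * g) mod 3 ^ n = (m + 2 * g') mod (3 ^ n :: nat)"
  using assms by (intro mod_add_cong mod_mult_cong) simp_all

lemma sE_mod_cong:
  assumes "g mod 3 ^ n = g' mod 3 ^ n"
  shows "sE m n g = sE m n g'"
  unfolding sE_def
  using digit3_mod_cong[OF assms] digit3_mod_cong[OF mod_3_power_cong_add_double[OF assms, of m]] by simp

lemma valid3_mod_cong:
  assumes "g mod 3 ^ n = g' mod 3 ^ n"
  shows "valid3 m n g = valid3 m n g'"
  unfolding valid3_def
  using digit3_mod_cong[OF assms] digit3_mod_cong[OF mod_3_power_cong_add_double[OF assms, of m]] by simp

lemma carry3_mod_cong:
  "g mod 3 ^ n = g' mod 3 ^ n \<Longrightarrow> carry3 m n g = carry3 m n g'"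
  by (simp add: carry3_def)

text \<open>At the lowest digit where \<open>g\<close> and \<open>g'\<close> differ the carries
  still agree, so both factors belong to the same \<open>s\<close> and \<open>sfac_orth\<close>
  applies.\<close>

lemma sE_orth:
  assumes "CHAR('a::comm_ring_1) = 3" "valid3 m n g" "valid3 m n g'" "g mod 3 ^ n \<noteq> g' mod 3 ^ n"
  shows "sE m n g * sE m n g' = (0 :: 'a salg)"
  using assms(2-)
proof (induction n)
  case 0
  then show ?case by simp
next
  case (Suc n)
  let ?E = "sE m n g :: 'a salg" and ?E' = "sE m n g' :: 'a salg"
  let ?f = "\<lambda>g. sfac (digit3 g n) (digit3 (m + 2 * g) n) (sb (3 ^ n)) (sb (2 * 3 ^ n)) :: 'a salg"
  have v: "valid3 m n g" "digit3 g n \<le> digit3 (m + 2 * g) n"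
     and v': "valid3 m n g'" "digit3 g' n \<le> digit3 (m + 2 * g') n"
    using Suc.prems by (simp_all add: valid3_Suc)
  have *: "sE m (Suc n) g * sE m (Suc n) g' = ?E * ?E' * ?f g * ?f g'"
    unfolding sE_Suc by (simp only: ac_simps)
  show ?case
  proof (cases "g mod 3 ^ n = g' mod 3 ^ n")
    case True
    have "digit3 g n \<noteq> digit3 g' n"
      using Suc.prems(3) True by (simp add: mod_3_power_Suc del: power_Suc)
    moreover note c = carry3_mod_cong[OF True, of m]
    ultimately have "?E * ?f g * ?f g' = 0"
      using sfac_orth[OF srel_sE[OF assms(1) v(1)] salg_three_eq_0[OF assms(1)] _ digit3_less _ digit3_less, of g n g' n] v(2) v'(2)
      by (simp only: digit3_add_double'[symmetric] c) (simp add: digit3_add_double' c)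
    then show ?thesis
      unfolding * using sE_mod_cong[OF True, of m] sE_idem[OF assms(1) v(1)] by metis
  next
    case False
    then show ?thesis unfolding * using Suc.IH[OF v(1) v'(1)] by simp
  qed
qed

text \<open>Group the indices by their residue \<open>h\<close> modulo \<open>3 ^ n\<close>. Lower
  product and carry depend on \<open>h\<close> only, and over the top digit \<open>a\<close> the
  admissible factors add up to 1 by \<open>sfac_sum\<close>.\<close>

lemma sE_sum:
  assumes "CHAR('a::comm_ring_1) = 3"
  shows "(\<Sum>g<3 ^ n. if valid3 m n g then sE m n g else 0) = (scomp m 1 :: 'a salg)"
proof (induction n)
  case 0
  then show ?case by (simp add: valid3_def)
next
  case (Suc n)
  let ?q = "3 ^ n :: nat"
  let ?F = "\<lambda>g. if valid3 m (Suc n) g then sE m (Suc n) g else (0 :: 'a salg)"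
  have "(\<Sum>g<3 ^ Suc n. ?F g) = (\<Sum>a<3. sum ?F {a * ?q..<a * ?q + ?q})"
    using sum.nat_group[of ?F ?q 3] by simp
  also have "\<dots> = (\<Sum>a<3. \<Sum>h<?q. ?F (a * ?q + h))"
  proof (rule sum.cong[OF refl])
    fix a
    show "sum ?F {a * ?q..<a * ?q + ?q} = (\<Sum>h<?q. ?F (a * ?q + h))"
      using sum.shift_bounds_nat_ivl[of ?F 0 "a * ?q" ?q]
      by (simp only: lessThan_atLeast0 add_0 add.commute[of "a * ?q"])
  qed
  also have "\<dots> = (\<Sum>h<?q. \<Sum>a<3. ?F (a * ?q + h))" by (rule sum.swap)
  also have "\<dots> = (\<Sum>h<?q. if valid3 m n h then sE m n h else 0)"
  proof (rule sum.cong[OF refl])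
    fix h assume "h \<in> {..<?q}"
    then have h: "h < ?q" by simp
    let ?s = "(digit3 m n + carry3 m n h) mod 3"
    have "?F (a * ?q + h) = (if valid3 m n h then sE m n h *
        (if a \<le> (?s + 2 * a) mod 3 then sfac a ((?s + 2 * a) mod 3) (sb ?q) (sb (2 * ?q)) else 0) else 0)"
      if "a \<in> {..<3}" for a
    proof -
      have m: "(a * ?q + h) mod ?q = h mod ?q" by simp
      have d: "digit3 (a * ?q + h) n = a" using h that by (simp add: digit3_def)
      have dd: "digit3 (m + 2 * (a * ?q + h)) n = (?s + 2 * a) mod 3"
        by (simp only: digit3_add_double' d carry3_mod_cong[OF m])
      show ?thesis
        by (simp only: valid3_Suc sE_Suc valid3_mod_cong[OF m] sE_mod_cong[OF m] d dd) auto
    qed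
    then have "(\<Sum>a<3. ?F (a * ?q + h)) = (if valid3 m n h then sE m n h *
       (\<Sum>a<3. if a \<le> (?s + 2 * a) mod 3 then sfac a ((?s + 2 * a) mod 3) (sb ?q) (sb (2 * ?q)) else 0) else 0)"
      by (simp add: sum_distrib_left)
    also have "\<dots> = (if valid3 m n h then sE m n h else 0)"
      by (subst sfac_sum) simp_all
    finally show "(\<Sum>a<3. ?F (a * ?q + h)) = (if valid3 m n h then sE m n h else 0)" .
  qed
  finally show ?case using Suc.IH by simp
qed

text \<open>Split \<open>i = a * 3 ^ n + r\<close>: the basis element factors accordingly,
  \<open>r\<close> is covered by induction and a nonzero \<open>a\<close> by
  \<open>sfac_cube\<close>.\<close>

lemma sE_sb_cube:
  assumes "CHAR('a::comm_ring_1) = 3" "valid3 m n g" "i < 3 ^ n"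
  shows "\<exists>k. sE m n g * sb i ^ 3 = of_nat k * (sE m n g :: 'a salg)"
  using assms(2,3)
proof (induction n arbitrary: i)
  case 0
  then show ?case by (auto simp: sb_0 intro: exI[of _ 1])
next
  case (Suc n)
  let ?E = "sE m n g :: 'a salg" and ?q = "3 ^ n :: nat"
  let ?f = "sfac (digit3 g n) (digit3 (m + 2 * g) n) (sb (3 ^ n)) (sb (2 * 3 ^ n)) :: 'a salg"
  have v: "valid3 m n g" and le: "digit3 g n \<le> digit3 (m + 2 * g) n"
    using Suc.prems by (simp_all add: valid3_Suc)
  define a r where "a = i div ?q" and "r = i mod ?q"
  have r: "r < ?q" by (simp add: r_def)
  have i: "i = a * ?q + r" unfolding a_def r_def by (rule div_mult_mod_eq[symmetric])
  have a: "a < 3" using Suc.prems(2) by (simp add: a_def div_less_iff_less_mult)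
  have p: "prime (3::nat)" by simp
  have sb: "sb i = sb (a * ?q) * (sb r :: 'a salg)"
    unfolding i using sb_mult_sb_less[OF assms(1) p r, of a] by simp
  obtain k where k: "?E * sb r ^ 3 = of_nat k * ?E" using Suc.IH[OF v r] by blast
  note C = sfac_cube[OF srel_sE[OF assms(1) v] salg_three_eq_0[OF assms(1)] _ digit3_less, of g n]
  have C1: "\<exists>k. ?E * ?f * sb ?q ^ 3 = of_nat k * (?E * ?f)"
    using C(1) le by (simp only: digit3_add_double'[symmetric]) (simp add: power3_eq_cube mult.assoc)
  have C2: "\<exists>k. ?E * ?f * sb (2 * ?q) ^ 3 = of_nat k * (?E * ?f)"
    using C(2) le by (simp only: digit3_add_double'[symmetric]) (simp add: power3_eq_cube mult.assoc)
  have "\<exists>k. ?E * ?f * sb (a * ?q) ^ 3 = of_nat k * (?E * ?f)"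
  proof -
    consider "a = 0" | "a = 1" | "a = 2" using a by linarith
    then show ?thesis
    proof cases
      case 1 then show ?thesis by (auto simp: sb_0 intro: exI[of _ 1])
    qed (use C1 C2 in simp_all)
  qed
  then obtain l where l: "?E * ?f * sb (a * ?q) ^ 3 = of_nat l * (?E * ?f)" by blast
  have "?E * ?f * sb i ^ 3 = (?E * sb r ^ 3) * (?f * sb (a * ?q) ^ 3)"
    unfolding sb power_mult_distrib by (simp only: ac_simps)
  also have "\<dots> = of_nat k * (?E * ?f * sb (a * ?q) ^ 3)" unfolding k by (simp only: ac_simps)
  also have "\<dots> = of_nat (k * l) * (?E * ?f)" unfolding l by (simp add: mult.assoc)
  finally show ?case unfolding sE_Suc by blast
qed

section \<open>Lowest terms of the partial products\<close>

lemma coef_mult_sb_multiple: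
  assumes "CHAR('a::comm_ring_1) = p" "prime p" "\<And>h. p ^ u \<le> h \<Longrightarrow> coef x m h = 0"
  shows "coef (x * sb (a * p ^ u) :: 'a salg) m h = (if h div p ^ u = a then coef x m (h mod p ^ u) else 0)"
proof -
  let ?q = "p ^ u"
  have q: "0 < ?q" using assms(2) prime_gt_0_nat by simp
  define N where "N = h + a * ?q + ?q"
  have "coef (x * sb (a * ?q)) m h = (\<Sum>i\<le>N. \<Sum>j\<le>N. if a * ?q = j then coef x m i * of_nat (scoef m i j h) else 0)"
    by (subst coef_mult_ext[of h N]) (simp add: N_def, intro sum.cong refl, simp)
  also have "\<dots> = (\<Sum>i\<le>N. coef x m i * of_nat (scoef m i (a * ?q) h))" by (simp add: N_def)
  also have "\<dots> = (\<Sum>i\<in>{..<?q}. coef x m i * of_nat (scoef m i (a * ?q) h))"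
    using assms(3) by (intro sum.mono_neutral_right) (auto simp: N_def)
  also have "\<dots> = (\<Sum>i\<in>{..<?q}. if h mod ?q = i then if h div ?q = a then coef x m i else 0 else 0)"
  proof (intro sum.cong refl)
    fix i assume "i \<in> {..<?q}"
    then have i: "i < ?q" by simp
    have "(of_nat (scoef m i (a * ?q) h) :: 'a) = coef (sb (a * ?q) * sb i) m h"
      by (simp add: coef_sb_mult scoef_commute)
    also have "\<dots> = (if h = a * ?q + i then 1 else 0)"
      by (simp add: sb_mult_sb_less[OF assms(1,2) i])
    finally show "coef x m i * of_nat (scoef m i (a * ?q) h) = (if h mod ?q = i then if h div ?q = a then coef x m i else 0 else 0)"
      using eq_mult_add_iff[OF i, of h a] by simp
  qed
  also have "\<dots> = (if h div ?q = a then coef x m (h mod ?q) else 0)" using q by simp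
  finally show ?thesis .
qed

text \<open>Multiplication by a basis element at \<open>a * 3 ^ u\<close> moves the support of
  \<open>E\<close> into block \<open>a\<close>, and the lowest term of the factor is
  \<open>sb (g * 3 ^ u)\<close> up to sign.\<close>

lemma coef_mult_sfac:
  assumes "CHAR('a::comm_ring_1) = 3" "\<forall>h\<ge>3 ^ u. coef E m h = 0" "g \<le> n" "n < 3"
  defines "x \<equiv> E * sfac g n (sb (3 ^ u)) (sb (2 * 3 ^ u)) :: 'a salg"
  shows "h div 3 ^ u < g \<or> 3 \<le> h div 3 ^ u \<Longrightarrow> coef x m h = 0"
    and "h div 3 ^ u = g \<Longrightarrow> coef x m h = coef E m (h mod 3 ^ u) \<or> coef x m h = - coef E m (h mod 3 ^ u)"
    and "coef E m (h mod 3 ^ u) = 0 \<Longrightarrow> coef x m h = 0"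
proof -
  have p: "prime (3::nat)" by simp
  note c = coef_mult_sb_multiple[OF assms(1) p assms(2)[rule_format]]
  have c0: "coef E m h = (if h div 3 ^ u = 0 then coef E m (h mod 3 ^ u) else 0)"
    using c[where a=0] by (simp add: sb_0)
  have c1: "coef (E * sb (3 ^ u)) m h = (if h div 3 ^ u = 1 then coef E m (h mod 3 ^ u) else 0)"
    using c[where a=1] by simp
  note c2 = c[where a=2]
  consider "g = 0" "n = 0" | "g = 0" "n = 1" | "g = 0" "n = 2" | "g = 1" "n = 1" | "g = 1" "n = 2" | "g = 2" "n = 2"
    using assms(3,4) by linarith
  then have "(h div 3 ^ u < g \<or> 3 \<le> h div 3 ^ u \<longrightarrow> coef x m h = 0)
    \<and> (h div 3 ^ u = g \<longrightarrow> coef x m h = coef E m (h mod 3 ^ u) \<or> coef x m h = - coef E m (h mod 3 ^ u))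
    \<and> (coef E m (h mod 3 ^ u) = 0 \<longrightarrow> coef x m h = 0)"
    unfolding x_def
    by cases (simp_all add: sfac_def distrib_left right_diff_distrib c1 c2, (subst c0, simp)+)
  then show "h div 3 ^ u < g \<or> 3 \<le> h div 3 ^ u \<Longrightarrow> coef x m h = 0"
    and "h div 3 ^ u = g \<Longrightarrow> coef x m h = coef E m (h mod 3 ^ u) \<or> coef x m h = - coef E m (h mod 3 ^ u)"
    and "coef E m (h mod 3 ^ u) = 0 \<Longrightarrow> coef x m h = 0" by blast+
qed

text \<open>Serves twice after truncation at \<open>l\<close>: the leading coefficient shows that
  the elements with \<open>g \<le> l\<close> are nonzero, and the leading index that those with
  \<open>l < g < 3 ^ l\<close> vanish.\<close>

lemma coef_sE:
  assumes "CHAR('a::comm_ring_1) = 3" "valid3 m n g"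
  shows "(\<forall>h. h < g mod 3 ^ n \<or> 3 ^ n \<le> h \<longrightarrow> coef (sE m n g :: 'a salg) m h = 0)
     \<and> coef (sE m n g :: 'a salg) m (g mod 3 ^ n) \<in> {1, -1}"
  using assms(2)
proof (induction n)
  case 0
  then show ?case by simp
next
  case (Suc n)
  let ?E = "sE m n g :: 'a salg" and ?q = "3 ^ n :: nat"
  have v: "valid3 m n g" and le: "digit3 g n \<le> digit3 (m + 2 * g) n"
    using Suc.prems by (simp_all add: valid3_Suc)
  note IH = Suc.IH[OF v]
  have sup: "\<forall>h\<ge>3 ^ n. coef ?E m h = 0" using IH by blast
  note C = coef_mult_sfac[OF assms(1) sup le digit3_less, folded sE_Suc]
  have "coef (sE m (Suc n) g :: 'a salg) m h = 0" if "h < g mod 3 ^ Suc n \<or> 3 ^ Suc n \<le> h" for h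
  proof (cases "3 ^ Suc n \<le> h")
    case True
    then have "3 \<le> h div ?q" by (simp add: less_eq_div_iff_mult_less_eq)
    then show ?thesis by (rule C(1)[OF disjI2])
  next
    case False
    then have h: "h div ?q * ?q + h mod ?q < digit3 g n * ?q + g mod ?q"
      using that by (simp add: mod_3_power_Suc div_mult_mod_eq del: power_Suc)
    consider "h div ?q < digit3 g n" | "h mod ?q < g mod ?q"
    proof -
      have "h mod ?q < g mod ?q" if "\<not> h div ?q < digit3 g n"
      proof -
        have "digit3 g n * ?q \<le> h div ?q * ?q" using that by (intro mult_le_mono1) simp
        then show ?thesis using h by linarith
      qed
      then show thesis using that by blast
    qed
    then show ?thesis
    proof cases
      case 1 then show ?thesis by (rule C(1)[OF disjI1])
    next
      case 2
      then have "coef ?E m (h mod ?q) = 0" using conjunct1[OF IH, rule_format, of "h mod ?q"] by simp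
      then show ?thesis by (rule C(3))
    qed
  qed
  moreover have "coef (sE m (Suc n) g :: 'a salg) m (g mod 3 ^ Suc n) \<in> {1, -1}"
  proof -
    have "g mod 3 ^ Suc n div ?q = digit3 g n" by (simp add: digit3_eq_mod_div)
    moreover have "g mod 3 ^ Suc n mod ?q = g mod ?q" unfolding mod_3_power_Suc by simp
    ultimately show ?thesis using C(2)[of "g mod 3 ^ Suc n"] IH by auto
  qed
  ultimately show ?case by blast
qed


section \<open>Truncation\<close>

text \<open>Projection to the component \<open>m\<close>, followed by the quotient by the span of
  the basis elements above \<open>l\<close>. That span is an ideal because
  \<open>scoef m i j h\<close> vanishes for \<open>h < max i j\<close>.\<close>

definition strunc :: "nat \<Rightarrow> nat \<Rightarrow> 'a::field salg \<Rightarrow> nat \<Rightarrow> 'a" where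
  "strunc m l x = (\<lambda>h. if h \<le> l then coef x m h else 0)"

lemma strunc_in_Scarrier: "strunc m l x \<in> Scarrier l"
  by (simp add: strunc_def Scarrier_def)

lemma strunc_mult: "strunc m l (x * y) = Smult m l (strunc m l x) (strunc m l y)"
  by (rule ext) (simp add: strunc_def Smult_def coef_mult_ext)

lemma strunc_add: "strunc m l (x + y) = strunc m l x + strunc m l y"
  and strunc_diff: "strunc m l (x - y) = strunc m l x - strunc m l y"
  and strunc_0: "strunc m l 0 = 0"
  by (rule ext; simp add: strunc_def)+

lemma strunc_sb: "strunc m l (sb a) = Sb l a"
  by (rule ext) (auto simp: strunc_def Sb_def)

lemma strunc_1: "strunc m l 1 = Sone l"
  unfolding Sone_def sb_0[symmetric] strunc_sb ..

lemma strunc_sum: "strunc m l (sum f A) = (\<Sum>a\<in>A. strunc m l (f a))"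
  by (induction A rule: infinite_finite_induct) (simp_all add: strunc_0 strunc_add)

lemma strunc_scomp_mult: "strunc m l (scomp m c * x) = (\<lambda>h. c * strunc m l x h)"
  by (rule ext) (simp add: strunc_def)

text \<open>This lift is a finite sum of scalars times basis elements, the form treated by
  \<open>sE_cube\<close>.\<close>

lemma strunc_surj:
  assumes "a \<in> Scarrier l"
  shows "strunc m l (\<Sum>i\<le>l. scomp m (a i) * sb i) = a"
proof (rule ext)
  fix h
  have "(\<Sum>i\<le>l. a i * (if h = i then 1 else 0)) = (\<Sum>i\<le>l. if h = i then a i else 0)"
    by (rule sum.cong) auto
  then show "strunc m l (\<Sum>i\<le>l. scomp m (a i) * sb i) h = a h"
    using assms by (simp add: strunc_def Scarrier_def)
qed

lemma efactor_eq_strunc: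
  "efactor m l g u = strunc m l (sfac (digit3 g u) (digit3 (m + 2 * g) u) (sb (3 ^ u)) (sb (2 * 3 ^ u)))"
  unfolding efactor_def sfac_def Let_def
  by (simp add: strunc_add strunc_diff strunc_1 strunc_sb)

lemma foldr_Smult_strunc:
  "foldr (Smult m l) (map (\<lambda>u. strunc m l (f u)) us) (Sone l) = strunc m l (prod_list (map f us))"
  by (induction us) (simp_all add: strunc_1 strunc_mult)

lemma emg_eq_strunc: "emg m l g = strunc m l (sE m (m + 2 * g + l + 1) g)"
proof -
  have prod: "prod_list (map f [0..<n]) = (\<Prod>u<n. f u)" for f :: "nat \<Rightarrow> 'a salg" and n
    by (induction n) simp_all
  show ?thesis
    unfolding emg_def efactor_eq_strunc foldr_Smult_strunc prod sE_def strunc_scomp_mult by simp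
qed

lemma digit3_eq_0: "g < 3 ^ n \<Longrightarrow> digit3 g n = 0"
  by (simp add: digit3_def)

lemma less_3_power: "l \<le> n \<Longrightarrow> l < 3 ^ (n::nat)"
  using power_gt_expt[of 3 n] by simp

text \<open>For \<open>n \<ge> l\<close> both \<open>3 ^ n\<close> and \<open>2 * 3 ^ n\<close>
  exceed \<open>l\<close>, and digit \<open>n\<close> of \<open>g\<close> is 0, so the factor
  truncates to 1.\<close>

lemma strunc_sE_stable:
  assumes "g \<le> l" "l \<le> n"
  shows "strunc m l (sE m n g) = strunc m l (sE m l g)"
  using assms(2)
proof (induction n rule: dec_induct)
  case (step n)
  have l: "l < 3 ^ n" using step less_3_power by simp
  then have "digit3 g n = 0" using assms(1) by (intro digit3_eq_0) simp
  moreover have "Sb l (3 ^ n) = (0 :: nat \<Rightarrow> 'a)" "Sb l (2 * 3 ^ n) = (0 :: nat \<Rightarrow> 'a)"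
    using l by (auto simp: Sb_def)
  ultimately have "strunc m l (sfac (digit3 g n) (digit3 (m + 2 * g) n) (sb (3 ^ n)) (sb (2 * 3 ^ n)) :: 'a salg) = strunc m l 1"
    unfolding sfac_def by (simp add: strunc_add strunc_diff strunc_1 strunc_sb)
  then have "strunc m l (sE m (Suc n) g :: 'a salg) = strunc m l (sE m n g * 1)"
    unfolding sE_Suc strunc_mult by simp
  then show ?case using step.IH by simp
qed simp

lemma emg_eq_strunc_sE: "g \<le> l \<Longrightarrow> emg m l g = strunc m l (sE m l g)"
  unfolding emg_eq_strunc by (rule strunc_sE_stable) simp_all

section \<open>Lucas' criterion for the index set\<close>

lemma three_dvd_choose_iff: "a < 3 \<Longrightarrow> b < 3 \<Longrightarrow> 3 dvd (a choose b) \<longleftrightarrow> a < b"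
proof -
  assume "a < 3" "b < 3"
  then have "a \<in> {0,1,2}" "b \<in> {0,1,2}" by auto
  then show ?thesis by (auto simp: choose_two)
qed

lemma three_dvd_choose_mod_power_iff:
  "3 dvd (a mod 3 ^ n choose (b mod 3 ^ n)) \<longleftrightarrow> (\<exists>u<n. digit3 a u < digit3 b u)"
proof (induction n)
  case (Suc n)
  have p: "prime (3::nat)" by simp
  have "[(a mod 3 ^ Suc n choose (b mod 3 ^ Suc n)) = (digit3 a n choose digit3 b n) * (a mod 3 ^ n choose (b mod 3 ^ n))] (mod 3)"
    unfolding mod_3_power_Suc by (rule lucas_prime_power[OF p]) simp_all
  then have "3 dvd (a mod 3 ^ Suc n choose (b mod 3 ^ Suc n))
      \<longleftrightarrow> 3 dvd (digit3 a n choose digit3 b n) * (a mod 3 ^ n choose (b mod 3 ^ n))"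
    by (rule cong_dvd_iff)
  then show ?case
    using Suc.IH by (auto simp: prime_dvd_mult_iff[OF p] three_dvd_choose_iff digit3_less less_Suc_eq simp del: power_Suc)
qed simp

text \<open>The digits of \<open>g\<close> from position \<open>l\<close> on are 0, so the test on
  the lowest \<open>l\<close> digits decides all of them.\<close>

lemma not_dvd_Bmg_iff_valid3:
  assumes "g \<le> l"
  shows "\<not> 3 dvd Bmg m g \<longleftrightarrow> valid3 m l g"
proof -
  define N where "N = m + 2 * g + l"
  have "m + 2 * g < 3 ^ N" "g < 3 ^ N" by (simp_all add: N_def less_3_power)
  then have "\<not> 3 dvd Bmg m g \<longleftrightarrow> valid3 m N g"
    using three_dvd_choose_mod_power_iff[of "m + 2 * g" N g]
    by (simp add: Bmg_def valid3_def) (metis not_less)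
  also have "\<dots> \<longleftrightarrow> valid3 m l g"
  proof -
    have "digit3 g u = 0" if "\<not> u < l" for u
      using that assms by (intro digit3_eq_0 less_3_power) simp
    then show ?thesis unfolding valid3_def N_def by (metis le0 trans_less_add2)
  qed
  finally show ?thesis .
qed

section \<open>Cubes as scalars, and primitivity\<close>

lemma cube_sum_char3:
  assumes "(3 :: 'r::comm_ring_1) = 0"
  shows "(\<Sum>i\<in>A. f i :: 'r) ^ 3 = (\<Sum>i\<in>A. f i ^ 3)"
proof -
  have add: "(x + y) ^ 3 = x ^ 3 + y ^ 3" for x y :: 'r
  proof -
    have "(x + y) ^ 3 = x ^ 3 + y ^ 3 + 3 * (x * x * y + x * y * y)"
      by (simp add: power3_eq_cube algebra_simps)
    then show ?thesis using assms by simp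
  qed
  show ?thesis by (induction A rule: infinite_finite_induct) (simp_all add: add)
qed

lemma scomp_sum: "(\<Sum>i\<in>A. scomp m (f i)) = scomp m (\<Sum>i\<in>A. f i)"
proof (rule salg_eqI)
  fix n h
  show "coef (\<Sum>i\<in>A. scomp m (f i)) n h = coef (scomp m (\<Sum>i\<in>A. f i)) n h"
    by (cases "n = m \<and> h = 0") auto
qed

lemma scomp_power: "0 < n \<Longrightarrow> scomp m c ^ n = scomp m (c ^ n)"
  by (induction n rule: nat_induct_non_zero) (simp_all add: scomp_mult)

lemma scomp_of_nat_mult: "scomp m c * (of_nat k * x) = scomp m (c * of_nat k) * x"
  by (rule salg_eqI) simp

lemma sE_cube:
  assumes "CHAR('a::comm_ring_1) = 3" "valid3 m n g" "l < 3 ^ n"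
  shows "\<exists>s. sE m n g * (\<Sum>i\<le>l. scomp m (a i) * sb i) ^ 3 = scomp m s * (sE m n g :: 'a salg)"
proof -
  have "\<forall>i\<in>{..l}. \<exists>k. sE m n g * sb i ^ 3 = of_nat k * (sE m n g :: 'a salg)"
    using sE_sb_cube[OF assms(1,2)] assms(3) by auto
  then obtain k where k: "\<And>i. i \<le> l \<Longrightarrow> sE m n g * sb i ^ 3 = of_nat (k i) * (sE m n g :: 'a salg)"
    by (metis atMost_iff)
  have "sE m n g * (\<Sum>i\<le>l. scomp m (a i) * sb i) ^ 3 = (\<Sum>i\<le>l. scomp m (a i ^ 3) * (sE m n g * sb i ^ 3))"
    unfolding cube_sum_char3[OF salg_three_eq_0[OF assms(1)]]
    by (simp add: sum_distrib_left power_mult_distrib scomp_power mult.left_commute)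
  also have "\<dots> = (\<Sum>i\<le>l. scomp m (a i ^ 3 * of_nat (k i)) * sE m n g)"
    by (intro sum.cong refl) (simp add: k scomp_of_nat_mult)
  also have "\<dots> = scomp m (\<Sum>i\<le>l. a i ^ 3 * of_nat (k i)) * sE m n g"
    by (simp add: sum_distrib_right[symmetric] scomp_sum)
  finally show ?thesis by blast
qed

lemma emg_primitive:
  assumes char: "CHAR('a::field) = 3" and g: "g \<le> l" and v: "valid3 m l g"
  shows "Sprimitive_idem m l (emg m l g :: nat \<Rightarrow> 'a)"
proof -
  let ?E = "sE m l g :: 'a salg"
  define e where "e = (emg m l g :: nat \<Rightarrow> 'a)"
  have e: "e = strunc m l ?E" unfolding e_def by (rule emg_eq_strunc_sE[OF g])
  have ee: "Smult m l e e = e"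
    unfolding e strunc_mult[symmetric] sE_idem[OF char v] ..
  have g3: "g < 3 ^ l" using g by (rule less_3_power)
  have eg: "e g \<noteq> 0"
    using coef_sE[OF char v] g g3 by (auto simp: e strunc_def)
  have "a = 0 \<or> b = 0" if a: "Sidem m l a" and b: "Sidem m l b" and ab: "Smult m l a b = 0" and sum: "a + b = e" for a b
  proof -
    \<comment> \<open>A lift to the completed algebra. It need not be idempotent there, so
      idempotency of \<open>a\<close> is used only after truncation.\<close>
    define X where "X = (\<lambda>a. \<Sum>i\<le>l. scomp m (a i) * sb i :: 'a salg)"
    have X: "strunc m l (X a) = a" "strunc m l (X b) = b"
      using a b by (simp_all add: X_def strunc_surj Sidem_def)
    have aa: "Smult m l a a = a" using a by (simp add: Sidem_def)
    have "Smult m l a e = strunc m l (X a * (X a + X b))"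
      by (simp only: strunc_mult strunc_add X sum)
    also have "\<dots> = a"
      by (simp only: distrib_left strunc_add strunc_mult X aa ab add_0_right)
    finally have ae: "Smult m l a e = a" .
    obtain s where s: "?E * X a ^ 3 = scomp m s * ?E"
      using sE_cube[OF char v less_3_power[OF order_refl]] unfolding X_def by blast
    \<comment> \<open>Truncated, this is \<open>a\<close> because \<open>a e = a\<close> and
      \<open>a a = a\<close>; untruncated, it is \<open>s\<close> times \<open>?E\<close>. Hence
      \<open>a\<close> is \<open>s\<close> times \<open>e\<close>.\<close>
    have "strunc m l (?E * X a ^ 3) = strunc m l (X a * (X a * (X a * ?E)))"
      by (simp add: power3_eq_cube ac_simps)
    also have "\<dots> = a" by (simp only: strunc_mult X e[symmetric] ae aa)
    finally have as: "a = (\<lambda>h. s * e h)"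
      unfolding s strunc_scomp_mult e by simp
    have "a = Smult m l a a" by (simp add: aa)
    also have "\<dots> = strunc m l ((scomp m s * ?E) * (scomp m s * ?E))"
      by (simp only: strunc_mult[of m l "scomp m s * ?E" "scomp m s * ?E"] strunc_scomp_mult as e)
    also have "(scomp m s * ?E) * (scomp m s * ?E) = scomp m s * scomp m s * (?E * ?E)"
      by (simp only: ac_simps)
    also have "strunc m l \<dots> = (\<lambda>h. s * s * e h)"
      by (simp only: scomp_mult sE_idem[OF char v] strunc_scomp_mult e)
    \<comment> \<open>Idempotency of \<open>a\<close> gives \<open>s = s^2\<close>, read off at the
      index \<open>g\<close>, where \<open>e\<close> does not vanish.\<close>
    finally have "s * e g = s * s * e g" using as by metis
    then have "s = 0 \<or> s = 1" using eg by simp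
    then show ?thesis
    proof
      assume "s = 0"
      then show ?thesis using as by (auto simp: fun_eq_iff)
    next
      assume "s = 1"
      then show ?thesis using as sum by simp
    qed
  qed
  moreover have "e \<noteq> 0" using eg by auto
  moreover have "Sidem m l e" unfolding Sidem_def e using ee strunc_in_Scarrier e by metis
  ultimately show ?thesis
    unfolding Sprimitive_idem_def e_def[symmetric] by blast
qed

lemma emg_orth:
  assumes "CHAR('a::field) = 3" "g \<le> l" "valid3 m l g" "g' \<le> l" "valid3 m l g'" "g \<noteq> g'"
  shows "Smult m l (emg m l g) (emg m l g') = (0 :: nat \<Rightarrow> 'a)"
proof -
  have "g mod 3 ^ l \<noteq> g' mod 3 ^ l" using assms(2,4,6) by (simp add: less_3_power)
  then show ?thesis
    using sE_orth[OF assms(1,3,5)] by (simp add: emg_eq_strunc_sE assms(2,4) strunc_mult[symmetric] strunc_0)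
qed

lemma emg_sum:
  assumes "CHAR('a::field) = 3"
  shows "(\<Sum>g | g \<le> l \<and> valid3 m l g. emg m l g) = (Sone l :: nat \<Rightarrow> 'a)"
proof -
  let ?G = "{g. g \<le> l \<and> valid3 m l g}"
  \<comment> \<open>The indices with \<open>l < g < 3 ^ l\<close> occur in \<open>sE_sum\<close>,
    but their terms start above \<open>l\<close> and truncate to zero.\<close>
  have z: "strunc m l (sE m l g) = (0 :: nat \<Rightarrow> 'a)" if "g < 3 ^ l" "\<not> g \<le> l" "valid3 m l g" for g
    using coef_sE[OF assms that(3)] that(1,2) by (auto simp: strunc_def fun_eq_iff)
  have "Sone l = strunc m l (scomp m 1 * 1 :: 'a salg)"
    by (simp only: strunc_scomp_mult) (simp add: strunc_1)
  also have "\<dots> = strunc m l (\<Sum>g<3 ^ l. if valid3 m l g then sE m l g else (0 :: 'a salg))"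
    by (simp add: sE_sum[OF assms])
  also have "\<dots> = (\<Sum>g<3 ^ l. strunc m l (if valid3 m l g then sE m l g else (0 :: 'a salg)))"
    by (rule strunc_sum)
  also have "\<dots> = (\<Sum>g\<in>?G. strunc m l (if valid3 m l g then sE m l g else (0 :: 'a salg)))"
    by (intro sum.mono_neutral_right) (auto simp: less_3_power strunc_0 z)
  also have "\<dots> = (\<Sum>g\<in>?G. emg m l g)"
    by (intro sum.cong refl) (simp add: emg_eq_strunc_sE)
  finally show ?thesis ..
qed

theorem theorem1p2:
  fixes r l1 l2 :: nat
  assumes "CHAR('a::field) = 3"
    and "0 < r" and "l1 + l2 = r" and "l2 \<le> l1"
  shows "complete_prim_orth_idems (l1 - l2) l2
           {(emg (l1 - l2) l2 g :: nat \<Rightarrow> 'a) | g. g \<le> l2 \<and> \<not> 3 dvd Bmg (l1 - l2) g}"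
proof -
  define m where "m = l1 - l2"
  let ?e = "emg m l2 :: nat \<Rightarrow> nat \<Rightarrow> 'a"
  let ?G = "{g. g \<le> l2 \<and> valid3 m l2 g}"
  have S: "{?e g | g. g \<le> l2 \<and> \<not> 3 dvd Bmg m g} = ?e ` ?G"
    using not_dvd_Bmg_iff_valid3[of _ l2 m] by blast
  have prim: "Sprimitive_idem m l2 (?e g)" if "g \<in> ?G" for g
    using emg_primitive[OF assms(1)] that by blast
  have orth: "Smult m l2 (?e g) (?e g') = 0" if "g \<in> ?G" "g' \<in> ?G" "g \<noteq> g'" for g g'
    using emg_orth[OF assms(1)] that by blast
  \<comment> \<open>A sum over a set counts each element once, so distinct indices must give
    distinct idempotents. Equal ones would be orthogonal to themselves, hence zero.\<close>
  have "inj_on ?e ?G"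
  proof (rule inj_onI, rule ccontr)
    fix g g' assume G: "g \<in> ?G" "g' \<in> ?G" and eq: "?e g = ?e g'" and ne: "g \<noteq> g'"
    have "?e g = Smult m l2 (?e g) (?e g)"
      using prim[OF G(1)] by (simp add: Sprimitive_idem_def Sidem_def)
    also have "\<dots> = 0" using orth[OF G ne] eq by simp
    finally show False using prim[OF G(1)] by (simp add: Sprimitive_idem_def)
  qed
  then have "sum id (?e ` ?G) = Sone l2"
    by (simp add: sum.reindex emg_sum[OF assms(1)])
  then have "complete_prim_orth_idems m l2 (?e ` ?G)"
    unfolding complete_prim_orth_idems_def using prim orth by auto
  then show ?thesis by (simp only: S[unfolded m_def] m_def)
qed

end
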